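(* Let $p$ be an odd prime, $q=p^m$, and let \[\ell(x)=\sum_{i=0}^{m-1}\sum_{j=0}^2b_{ij}x^{p^iq^j}\] with coefficients $b_{ij}\in\mathbb F_{q^3}$. Let $a\in\mathbb F_{q^3}^*$. Then the function $f(x)=\mathrm{Tr}(ax^{q+1})+\ell(x^2)$ is a planar function on $\mathbb F_{q^3}$ if and only if $\ell$ induces a permutation of $\mathbb F_{q^3}$ and, for each $i\in\{0,\dots,m-1\}$, \[\sum_{j=0}^2b_{ij}a^{2p^iq^{j+1}}=\begin{cases}0&\text{if }i\ne0,\\\mathrm N(a)&\text{if }i=0.\end{cases}\]
   Context: $\mathrm{Tr}$ and $\mathrm N$ denote the trace and norm from $\mathbb F_{q^3}$ to $\mathbb F_q$: $\mathrm{Tr}(y)=y+y^q+y^{q^2}$, $\mathrm N(y)=y^{1+q+q^2}$. A function $f$ on $\mathbb F_{q^n}$ is planar if for every $c\in\mathbb F_{q^n}^*$ the map $x\mapsto f(x+c)-f(x)$ is a permutation of $\mathbb F_{q^n}$. *)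

theory Defs
  imports Main "HOL-Computational_Algebra.Primes"
begin

definition Tr3 :: "nat \<Rightarrow> 'a::field \<Rightarrow> 'a" where
  "Tr3 q y = y + y ^ q + y ^ (q ^ 2)"

definition N3 :: "nat \<Rightarrow> 'a::field \<Rightarrow> 'a" where
  "N3 q y = y ^ (1 + q + q ^ 2)"

definition planar :: "('a::field \<Rightarrow> 'a) \<Rightarrow> bool" where
  "planar f \<longleftrightarrow> (\<forall>c. c \<noteq> 0 \<longrightarrow> bij (\<lambda>x. f (x + c) - f x))"

definition linpoly :: "nat \<Rightarrow> nat \<Rightarrow> (nat \<Rightarrow> nat \<Rightarrow> 'a::field) \<Rightarrow> 'a \<Rightarrow> 'a" where
  "linpoly p m b x = (\<Sum>i<m. \<Sum>j<3. b i j * x ^ (p ^ i * (p ^ m) ^ j))"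

end

theory Submission
  imports Defs "HOL-Number_Theory.Residues" "HOL-Computational_Algebra.Polynomial"
begin

text \<open>
  Write \<open>q = p\<^sup>m\<close>. Polarising \<open>f\<close> and substituting \<open>z = x c\<close>, planarity says that for every \<open>z \<noteq> 0\<close> the
  plane cubic \<open>N(c) (Tr(a z\<^sup>q c / c\<^sup>q + a z c\<^sup>q / c) + 2 \<ell>(z))\<close> has no rational point \<open>c\<close>, which is a
  cubic over \<open>F\<^sub>q\<close> as soon as \<open>\<ell>(z)\<close> lies in \<open>F\<^sub>q\<close>. A smooth plane cubic over a finite field has a
  rational point, so such a cubic is a triangle of conjugate lines, and this forces
  \<open>a \<ell>(z) = a\<^sup>q a\<^sup>q\<^sup>q z\<^sup>q\<^sup>q\<close>. Hence \<open>\<ell>\<close> is injective and \<open>\<ell>(a\<^sup>2\<^sup>q t) = N(a) t\<close> for \<open>t \<in> F\<^sub>q\<close>, which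
  is the coefficient condition. Conversely, under that condition the cubic is
  a multiple of \<open>N(a\<^sup>q\<^sup>q c + a\<^sup>q c\<^sup>q)\<close>.

  The existence of rational points is replaced by a direct argument. Let \<open>\<pi>\<close> be the Frobenius map. On pairs of points
  of the cubic there is a function (a Weierstrass function of their difference) whose only pole is
  a double pole on the diagonal. Composed with \<open>P \<mapsto> (P, \<pi> P)\<close> it has poles only at rational points;
  without rational points it is regular, hence constant. Since \<open>\<pi>\<close> has derivative 0, looking at the
  first-order expansion at the point \<open>(1, 0, 0)\<close> gives the required relation.
\<close>

section \<open>The cubic and a function with poles on the diagonal\<close>

definition cubic :: "'r::comm_ring_1 \<Rightarrow> 'r \<Rightarrow> 'r \<Rightarrow> 'r \<Rightarrow> 'r \<Rightarrow> 'r \<Rightarrow> 'r \<Rightarrow> 'r \<Rightarrow> 'r \<Rightarrow> 'r \<Rightarrow> 'r" where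
  "cubic a0 a1 a2 b0 b1 b2 s x y z =
     a0 * y\<^sup>2 * z + b0 * x\<^sup>2 * z + a1 * z\<^sup>2 * x + b1 * y\<^sup>2 * x + a2 * x\<^sup>2 * y + b2 * z\<^sup>2 * y - s * x * y * z"

text \<open>
  With \<open>p = (x, y, z)\<close> and \<open>p' = (x', y', z')\<close> on the cubic, \<open>wp_num / (x y' - x' y)\<^sup>2\<close> is the function with
  poles on the diagonal: if \<open>A, B, D, G, E, H, I\<close> are the coefficients of \<open>u\<^sup>2v, uv\<^sup>2, u\<^sup>2t, v\<^sup>2t, uvt, ut\<^sup>2, vt\<^sup>2\<close>
  in \<open>cubic (u p + v p' + t e)\<close>, then \<open>(E\<^sup>2 + 8 D G - 4 A I - 4 B H) / det(p, p', e)\<^sup>2\<close> does not depend on \<open>e\<close>.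
  For \<open>e = (0, 0, 1)\<close> its numerator is a constant multiple of \<open>det(p, p', e)\<^sup>2\<close> plus \<open>12 wp_num\<close>; dividing
  by 12 keeps the function meaningful in characteristic 3.
\<close>
definition wp_num :: "'r::comm_ring_1 \<Rightarrow> 'r \<Rightarrow> 'r \<Rightarrow> 'r \<Rightarrow> 'r \<Rightarrow> 'r \<Rightarrow> 'r \<Rightarrow> 'r \<Rightarrow> 'r \<Rightarrow> 'r \<Rightarrow> 'r \<Rightarrow> 'r \<Rightarrow> 'r \<Rightarrow> 'r" where
  "wp_num a0 a1 a2 b0 b1 b2 s x y z x' y' z' =
     (a0 * y\<^sup>2 + b0 * x\<^sup>2 - s * x * y + z * (a1 * x + b2 * y)) *
     (a0 * y'\<^sup>2 + b0 * x'\<^sup>2 - s * x' * y' + z' * (a1 * x' + b2 * y')) +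
     z * z' * (a1 * x + b2 * y) * (a1 * x' + b2 * y') -
     (a1 * a2 * x * x' * (x * y' + x' * y) + 2 * (a1 * b1 + a2 * b2) * x * x' * y * y' +
      b1 * b2 * y * y' * (x * y' + x' * y))"

text \<open>The choices e = (0, 0, 1) and e = (1, 0, 0) give the same function when both points lie
  on the cubic. The long factors are cofactors that certify this as ideal membership over any
  commutative ring.\<close>

lemma wp_num_identity:
  fixes x :: "'r::comm_ring_1"
  shows "wp_num a0 a1 a2 b0 b1 b2 s x y z x' y' z' * (y * z' - y' * z)\<^sup>2 -
    wp_num a1 a2 a0 b1 b2 b0 s y z x y' z' x' * (x * y' - x' * y)\<^sup>2 =
    cubic a0 a1 a2 b0 b1 b2 s x y z *
     (-a0*y*y'^3*z' +a0*z*y'^4 -a1*x*y'^2*z'^2 -a1*y*x'*y'*z'^2 +2*a1*z*x'*y'^2*z' -2*a2*x*x'*y'^3 +2*a2*y*x'^2*y'^2 -2*b0*x*x'*y'^2*z' +b0*y*x'^2*y'*z' +b0*z*x'^2*y'^2 -b1*x*y'^4 +b1*y*x'*y'^3 -2*b2*y*y'^2*z'^2 +2*b2*z*y'^3*z' +s*x*y'^3*z' -s*z*x'*y'^3) +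
    cubic a0 a1 a2 b0 b1 b2 s x' y' z' *
     (a0*y^4*z' -a0*y^3*z*y' +2*a1*x*y^2*z*z' -a1*x*y*z^2*y' -a1*y^2*z^2*x' +2*a2*x^2*y^2*y' -2*a2*x*y^3*x' +b0*x^2*y^2*z' +b0*x^2*y*z*y' -2*b0*x*y^2*z*x' +b1*x*y^3*y' -b1*y^4*x' +2*b2*y^3*z*z' -2*b2*y^2*z^2*y' -s*x*y^3*z' +s*y^3*z*x')"
  unfolding wp_num_def cubic_def power2_eq_square power3_eq_cube power4_eq_xxxx by (simp add: algebra_simps)

section \<open>Ideals of a subring\<close>

definition is_subring :: "'r::comm_ring_1 set \<Rightarrow> bool" where
  "is_subring B \<longleftrightarrow> 1 \<in> B \<and> (\<forall>x\<in>B. \<forall>y\<in>B. x + y \<in> B \<and> x * y \<in> B \<and> - x \<in> B)"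

text \<open>The conditions describe a \<open>B\<close>-submodule of the surrounding ring. They are
  relative to \<open>B\<close> because F[u, v] is later realised as a proper subset of a polynomial
  type.\<close>

definition ideal_of :: "'r::comm_ring_1 set \<Rightarrow> 'r set \<Rightarrow> bool" where
  "ideal_of B I \<longleftrightarrow> 0 \<in> I \<and> (\<forall>x\<in>I. \<forall>y\<in>I. x + y \<in> I) \<and> (\<forall>b\<in>B. \<forall>x\<in>I. b * x \<in> I)"

lemma
  assumes "is_subring B"
  shows subring_one: "1 \<in> B"
    and subring_add: "x \<in> B \<Longrightarrow> y \<in> B \<Longrightarrow> x + y \<in> B"
    and subring_mult: "x \<in> B \<Longrightarrow> y \<in> B \<Longrightarrow> x * y \<in> B"
    and subring_minus: "x \<in> B \<Longrightarrow> - x \<in> B"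
    and subring_diff: "x \<in> B \<Longrightarrow> y \<in> B \<Longrightarrow> x - y \<in> B"
    and subring_zero: "0 \<in> B"
    and subring_power: "x \<in> B \<Longrightarrow> x ^ n \<in> B"
    and subring_numeral: "numeral k \<in> B"
    and subring_prod: "(\<And>a. a \<in> A \<Longrightarrow> f a \<in> B) \<Longrightarrow> prod f A \<in> B"
proof -
  show one: "1 \<in> B"
    and add: "x \<in> B \<Longrightarrow> y \<in> B \<Longrightarrow> x + y \<in> B"
    and mult: "x \<in> B \<Longrightarrow> y \<in> B \<Longrightarrow> x * y \<in> B"
    and minus: "x \<in> B \<Longrightarrow> - x \<in> B" for x y
    using assms by (auto simp: is_subring_def)
  show diff: "x \<in> B \<Longrightarrow> y \<in> B \<Longrightarrow> x - y \<in> B" for x y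
    using add[of x "- y"] minus[of y] by simp
  show "0 \<in> B" using diff[OF one one] by simp
  show "x \<in> B \<Longrightarrow> x ^ n \<in> B"
    by (induction n) (auto intro: one mult)
  show "numeral k \<in> B"
    by (induction k) (simp_all only: numeral.simps one add)
  show "(\<And>a. a \<in> A \<Longrightarrow> f a \<in> B) \<Longrightarrow> prod f A \<in> B"
    by (induction A rule: infinite_finite_induct) (auto intro: one mult)
qed

lemma
  assumes "is_subring B" "ideal_of B I"
  shows ideal_zero: "0 \<in> I"
    and ideal_add: "x \<in> I \<Longrightarrow> y \<in> I \<Longrightarrow> x + y \<in> I"
    and ideal_mult: "b \<in> B \<Longrightarrow> x \<in> I \<Longrightarrow> b * x \<in> I"
    and ideal_mult2: "b \<in> B \<Longrightarrow> x \<in> I \<Longrightarrow> x * b \<in> I"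
    and ideal_diff: "x \<in> I \<Longrightarrow> y \<in> I \<Longrightarrow> x - y \<in> I"
proof -
  show "0 \<in> I"
    and add: "x \<in> I \<Longrightarrow> y \<in> I \<Longrightarrow> x + y \<in> I"
    and mult: "b \<in> B \<Longrightarrow> x \<in> I \<Longrightarrow> b * x \<in> I" for x y b
    using assms by (auto simp: ideal_of_def)
  show "b \<in> B \<Longrightarrow> x \<in> I \<Longrightarrow> x * b \<in> I"
    using mult[of b x] by (simp add: mult.commute)
  have "- 1 \<in> B" using subring_minus[OF assms(1) subring_one[OF assms(1)]] .
  then show "x \<in> I \<Longrightarrow> y \<in> I \<Longrightarrow> x - y \<in> I"
    using add[of x "- y"] mult[of "- 1" y] by simp
qed

lemma ideal_adjoin:
  assumes B: "is_subring B" and I: "ideal_of B I" and g: "g \<in> B"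
  shows "ideal_of B {i + g * b | i b. i \<in> I \<and> b \<in> B}"
  unfolding ideal_of_def
proof (intro conjI ballI)
  show "0 \<in> {i + g * b | i b. i \<in> I \<and> b \<in> B}"
    using ideal_zero[OF B I] subring_zero[OF B] by (auto intro!: exI[of _ 0])
next
  fix x y assume "x \<in> {i + g * b | i b. i \<in> I \<and> b \<in> B}" "y \<in> {i + g * b | i b. i \<in> I \<and> b \<in> B}"
  then obtain i b i' b' where "x = i + g * b" "y = i' + g * b'" "i \<in> I" "i' \<in> I" "b \<in> B" "b' \<in> B"
    by blast
  then have "x + y = (i + i') + g * (b + b')" "i + i' \<in> I" "b + b' \<in> B"
    using ideal_add[OF B I] subring_add[OF B] by (auto simp: algebra_simps)
  then show "x + y \<in> {i + g * b | i b. i \<in> I \<and> b \<in> B}" by blast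
next
  fix c x assume c: "c \<in> B" and "x \<in> {i + g * b | i b. i \<in> I \<and> b \<in> B}"
  then obtain i b where "x = i + g * b" "i \<in> I" "b \<in> B" by blast
  then have "c * x = c * i + g * (c * b)" "c * i \<in> I" "c * b \<in> B"
    using ideal_mult[OF B I c] subring_mult[OF B c] by (auto simp: distrib_left mult.left_commute)
  then show "c * x \<in> {i + g * b | i b. i \<in> I \<and> b \<in> B}" by blast
qed

text \<open>Invertibility modulo \<open>I\<close> passes from the factors to products and powers,
  and an element of \<open>I\<close> that is invertible modulo \<open>I\<close> forces 1 into
  \<open>I\<close>.\<close>

lemma ideal_one_of_prod_power:
  assumes B: "is_subring B" and I: "ideal_of B I" and A: "finite A"
    and f: "\<And>a. a \<in> A \<Longrightarrow> f a \<in> B"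
    and unit: "\<And>a. a \<in> A \<Longrightarrow> \<exists>b\<in>B. 1 - f a * b \<in> I"
    and power: "(\<Prod>a\<in>A. f a) ^ n \<in> I"
  shows "1 \<in> I"
proof -
  have step: "\<exists>b\<in>B. 1 - (g * h) * b \<in> I"
    if gh: "g \<in> B" "h \<in> B" "\<exists>b\<in>B. 1 - g * b \<in> I" "\<exists>b\<in>B. 1 - h * b \<in> I" for g h
  proof -
    obtain b c where bc: "b \<in> B" "c \<in> B" "1 - g * b \<in> I" "1 - h * c \<in> I" using gh by blast
    have eq: "1 - (g * h) * (b * c) = (1 - g * b) + (g * b) * (1 - h * c)"
      by (simp add: algebra_simps)
    have "1 - (g * h) * (b * c) \<in> I"
      unfolding eq by (intro ideal_add[OF B I] ideal_mult[OF B I] subring_mult[OF B] bc gh)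
    then show ?thesis using subring_mult[OF B bc(1,2)] by blast
  qed
  have base: "\<exists>b\<in>B. 1 - 1 * b \<in> I"
    using subring_one[OF B] ideal_zero[OF B I] by (intro bexI[of _ 1]) auto
  have prod: "\<exists>b\<in>B. 1 - (\<Prod>a\<in>A. f a) * b \<in> I"
    using A f unit
  proof (induction A rule: finite_induct)
    case empty
    then show ?case using base by simp
  next
    case (insert a A)
    have "\<exists>b\<in>B. 1 - (f a * prod f A) * b \<in> I"
      using insert by (intro step subring_prod[OF B]) auto
    then show ?case using insert.hyps by simp
  qed
  have "(\<Prod>a\<in>A. f a) \<in> B" using f by (rule subring_prod[OF B])
  then have "\<exists>b\<in>B. 1 - (\<Prod>a\<in>A. f a) ^ n * b \<in> I"
    using base prod by (induction n) (auto intro!: step subring_power[OF B] simp del: mult_1)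
  then obtain b where b: "b \<in> B" "1 - (\<Prod>a\<in>A. f a) ^ n * b \<in> I" by blast
  have "1 = (1 - (\<Prod>a\<in>A. f a) ^ n * b) + (\<Prod>a\<in>A. f a) ^ n * b" by simp
  then show ?thesis
    using ideal_add[OF B I b(2) ideal_mult2[OF B I b(1) power]] by simp
qed

text \<open>A weak Nullstellensatz: the power conditions confine the zeros of \<open>I\<close> to
  the finite grid \<open>A\<close> x \<open>A\<close>, and \<open>at_points\<close> excludes each
  grid point.\<close>

lemma ideal_one_of_local:
  assumes B: "is_subring B" and I: "ideal_of B I" and A: "finite A" "A \<subseteq> B"
    and xy: "x \<in> B" "y \<in> B"
    and power: "(\<Prod>a\<in>A. x - a) ^ n \<in> I" "(\<Prod>a\<in>A. y - a) ^ n \<in> I"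
    and at_points: "\<And>J a b. ideal_of B J \<Longrightarrow> I \<subseteq> J \<Longrightarrow> a \<in> A \<Longrightarrow> b \<in> A \<Longrightarrow>
      x - a \<in> J \<Longrightarrow> y - b \<in> J \<Longrightarrow> 1 \<in> J"
  shows "1 \<in> I"
proof (rule ideal_one_of_prod_power[OF B I A(1) _ _ power(1)])
  have in_B: "x - a \<in> B" "y - a \<in> B" if "a \<in> A" for a
    using that A xy by (auto intro!: subring_diff[OF B])
  show "x - a \<in> B" if "a \<in> A" for a using in_B that by blast
  define adj where "adj = (\<lambda>I g. {i + g * b | i b. i \<in> I \<and> b \<in> B})"
  have adj: "ideal_of B (adj J g)" "J \<subseteq> adj J g" "g \<in> adj J g" if "ideal_of B J" "g \<in> B" for J g
  proof -
    show "ideal_of B (adj J g)" unfolding adj_def by (rule ideal_adjoin[OF B that])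
    have "j = j + g * 0" for j by simp
    then show "J \<subseteq> adj J g" unfolding adj_def using subring_zero[OF B] by blast
    have "g = 0 + g * 1" by simp
    then show "g \<in> adj J g" unfolding adj_def using subring_one[OF B] ideal_zero[OF B that(1)] by blast
  qed
  \<comment> \<open>If \<open>J\<close> and \<open>g\<close> generate the unit ideal, then
    \<open>g\<close> is invertible modulo \<open>J\<close>. This serves for \<open>y - b\<close>
    modulo \<open>I\<close> and \<open>x - a\<close>, and then for \<open>x - a\<close> modulo
    \<open>I\<close>.\<close>
  have adj_one: "\<exists>b\<in>B. 1 - g * b \<in> J" if one: "1 \<in> adj J g" for J g
  proof -
    obtain i b where "1 = i + g * b" "i \<in> J" "b \<in> B" using one unfolding adj_def by blast
    then have "1 - g * b \<in> J" by (metis add_diff_cancel_right')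
    then show ?thesis using \<open>b \<in> B\<close> by blast
  qed
  show "\<exists>b\<in>B. 1 - (x - a) * b \<in> I" if a: "a \<in> A" for a
  proof (rule adj_one)
    let ?J = "adj I (x - a)"
    note J = adj[OF I in_B(1)[OF a]]
    show "1 \<in> ?J"
    proof (rule ideal_one_of_prod_power[OF B J(1) A(1)])
      show "(\<Prod>a\<in>A. y - a) ^ n \<in> ?J" using power(2) J(2) by blast
      show "y - b \<in> B" if "b \<in> A" for b using in_B that by blast
      show "\<exists>c\<in>B. 1 - (y - b) * c \<in> ?J" if b: "b \<in> A" for b
      proof (rule adj_one)
        note J' = adj[OF J(1) in_B(2)[OF b]]
        show "1 \<in> adj ?J (y - b)"
          using J J' by (intro at_points[OF J'(1) _ a b]) auto
      qed
    qed
  qed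
qed

text \<open>Both sides come from monic polynomials of degree \<open>q\<close> that agree at the
  \<open>q\<close> elements of \<open>A\<close>.\<close>

lemma frobenius_fixed_prod:
  fixes r :: "'r::idom"
  assumes A: "finite A" "card A = q" "\<And>a. a \<in> A \<Longrightarrow> a ^ q = a" and q: "q \<ge> 2"
  shows "r ^ q - r = (\<Prod>a\<in>A. r - a)"
proof -
  define P where "P = (monom 1 q - [:0, 1:] :: 'r poly)"
  have "degree P = q" "coeff P q = 1"
  proof -
    have d: "degree (monom (1::'r) q) = q" by (simp add: degree_monom_eq)
    have "P = monom 1 q + (- [:0, 1:])" by (simp add: P_def)
    then show "degree P = q" using d q by (metis degree_add_eq_left degree_minus degree_pCons_eq_if degree_1 one_pCons one_neq_zero pCons_eq_0_iff less_le_trans one_less_numeral_iff semiring_norm(76) degree_0 One_nat_def zero_neq_one)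
    have "coeff [:0, 1::'r:] q = 0" using q by (intro coeff_eq_0) simp
    then show "coeff P q = 1" by (simp add: P_def)
  qed
  moreover have "degree (\<Prod>a\<in>A. [:- a, 1:]) = q" "coeff (\<Prod>a\<in>A. [:- a, 1:]) q = 1"
  proof -
    show d: "degree (\<Prod>a\<in>A. [:- a, 1:]) = q"
      using A by (subst degree_prod_eq_sum_degree) auto
    have "lead_coeff (\<Prod>a\<in>A. [:- a, 1:]) = 1" by (simp add: lead_coeff_prod)
    then show "coeff (\<Prod>a\<in>A. [:- a, 1:]) q = 1" by (simp add: d)
  qed
  ultimately have "P = (\<Prod>a\<in>A. [:- a, 1:])"
    using A q
    by (intro poly_eqI_degree_lead_coeff[where n = q and A = A])
       (auto simp: P_def poly_monom poly_prod prod_zero_iff)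
  then have "poly P r = poly (\<Prod>a\<in>A. [:- a, 1:]) r" by simp
  then show ?thesis by (simp add: P_def poly_monom poly_prod)
qed

section \<open>Bivariate polynomials graded by total degree\<close>

text \<open>
  The outer variable is \<open>u\<close>, the inner one is \<open>t = v / u\<close>, for affine coordinates \<open>u, v\<close> of the plane. The
  subring below is the ring of polynomials in \<open>u\<close> and \<open>v\<close>; the total degree of its elements is the degree
  in \<open>u\<close>, and the top homogeneous part is the leading coefficient.
\<close>
definition graded_polys :: "'a::idom poly poly set" where
  "graded_polys = {P. \<forall>k. degree (coeff P k) \<le> k}"

lemma is_subring_graded_polys: "is_subring (graded_polys :: 'a::idom poly poly set)"
proof -
  have "P * Q \<in> graded_polys" if "P \<in> graded_polys" "Q \<in> graded_polys" for P Q :: "'a poly poly"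
  proof -
    have "degree (coeff P i * coeff Q (k - i)) \<le> k" if "i \<le> k" for i k
    proof -
      have "degree (coeff P i * coeff Q (k - i)) \<le> degree (coeff P i) + degree (coeff Q (k - i))"
        by (rule degree_mult_le)
      also have "\<dots> \<le> i + (k - i)"
        using \<open>P \<in> graded_polys\<close> \<open>Q \<in> graded_polys\<close> unfolding graded_polys_def by (intro add_mono) auto
      finally show ?thesis using that by simp
    qed
    then show ?thesis
      unfolding graded_polys_def mem_Collect_eq coeff_mult by (intro allI degree_sum_le) auto
  qed
  moreover have "(1 :: 'a poly poly) \<in> graded_polys"
    by (auto simp: graded_polys_def)
  ultimately show ?thesis
    unfolding is_subring_def by (auto simp: graded_polys_def intro: degree_add_le)
qed

lemma coeff_mult_add:
  fixes p r :: "'a::idom poly"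
  assumes "degree p \<le> m" "degree r \<le> n"
  shows "coeff (p * r) (m + n) = coeff p m * coeff r n"
proof (cases "degree p = m \<and> degree r = n")
  case True
  then show ?thesis using coeff_mult_degree_sum[of p r] by simp
next
  case False
  then have "coeff p m * coeff r n = 0" using assms by (auto simp: coeff_eq_0)
  moreover have "degree (p * r) < m + n"
    using assms False degree_mult_le[of p r] by linarith
  ultimately show ?thesis by (simp add: coeff_eq_0)
qed

text \<open>As \<open>p\<close> does not vanish at \<open>a\<close>, the cofactor does, and the
  linear factor can be cancelled from it. The factors are removed one at a time.\<close>

lemma dvd_mult_split_cancel:
  fixes p :: "'a::idom poly"
  assumes "finite A" "\<And>a. a \<in> A \<Longrightarrow> poly p a \<noteq> 0" "p dvd g * (\<Prod>a\<in>A. [:- a, 1:])"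
  shows "p dvd g"
  using assms
proof (induction A arbitrary: g rule: finite_induct)
  case (insert a A)
  have "p dvd g * [:- a, 1:]"
  proof (rule insert.IH)
    show "p dvd g * [:- a, 1:] * (\<Prod>a\<in>A. [:- a, 1:])"
      using insert.prems(2) insert.hyps by (simp only: prod.insert mult.assoc not_False_eq_True)
  qed (use insert.prems(1) in blast)
  then obtain h where h: "g * [:- a, 1:] = p * h" by blast
  then have "poly (p * h) a = 0" by (metis mult_zero_right poly_mult poly_eq_0_iff_dvd dvd_triv_right)
  then have "poly h a = 0" using insert.prems(1)[of a] by simp
  then obtain k where "h = [:- a, 1:] * k" by (auto simp: poly_eq_0_iff_dvd)
  then have "[:- a, 1:] * g = [:- a, 1:] * (p * k)" using h by (simp only: mult_ac)
  then have "g = p * k" by (subst (asm) mult_cancel_left) simp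
  then show ?case by simp
qed simp

lemma lead_coeff_dvd_coeff_mult:
  fixes p r :: "'a::idom poly"
  assumes "degree (p * r) \<le> n"
  shows "lead_coeff p dvd coeff (p * r) n"
proof (cases "degree (p * r) = n")
  case True
  then have "coeff (p * r) n = lead_coeff p * lead_coeff r" by (metis lead_coeff_mult)
  then show ?thesis by simp
qed (use assms in \<open>simp add: coeff_eq_0\<close>)

text \<open>A regular function without poles on the line at infinity is constant.\<close>
lemma quotient_constant:
  fixes f T L \<Phi> :: "'a::idom poly poly"
  assumes \<Phi>: "\<Phi> \<in> graded_polys" "degree \<Phi> = 3" "degree (coeff \<Phi> 3) = 3"
    and deg: "degree L \<le> n" "degree T \<le> 2 * n"
    and cancel: "\<And>g. coeff \<Phi> 3 dvd g * (coeff L n)\<^sup>2 \<Longrightarrow> coeff \<Phi> 3 dvd g"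
    and f: "f \<in> graded_polys" "\<Phi> dvd T - f * L\<^sup>2"
  shows "\<exists>c. \<Phi> dvd T - [:[:c:]:] * L\<^sup>2"
  using f
proof (induction "degree f" arbitrary: f rule: less_induct)
  case less
  let ?d = "degree f" and ?\<phi> = "coeff \<Phi> 3"
  note B = is_subring_graded_polys
  show ?case
  proof (cases "?d = 0")
    case True
    then obtain g where g: "f = [:g:]" by (rule degree_eq_zeroE)
    \<comment> \<open>By the grading, degree 0 in u forces degree 0 in t.\<close>
    then have "degree g = 0" using less.prems(1) by (auto simp: graded_polys_def dest: spec[of _ 0])
    then obtain c where "g = [:c:]" by (rule degree_eq_zeroE)
    then show ?thesis using g less.prems(2) by blast
  next
    case False
    obtain G where G: "T - f * L\<^sup>2 = \<Phi> * G" using less.prems(2) by blast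
    have L2: "degree (L\<^sup>2) \<le> 2 * n" "coeff (L\<^sup>2) (2 * n) = (coeff L n)\<^sup>2"
      using degree_mult_le[of L L] deg(1) coeff_mult_add[OF deg(1) deg(1)]
      by (auto simp: power2_eq_square mult_2)
    have fL2: "degree (f * L\<^sup>2) \<le> ?d + 2 * n"
      using degree_mult_le[of f "L\<^sup>2"] L2 by linarith
    have "degree (\<Phi> * G) \<le> ?d + 2 * n"
      unfolding G[symmetric] using deg(2) fL2 by (intro degree_diff_le) auto
    \<comment> \<open>Compare the coefficients of u^(d + 2n). \<open>T\<close> contributes nothing
      because d > 0, so by \<open>cancel\<close> the top form of \<open>f\<close> is a multiple of
      that of \<open>\<Phi>\<close>.\<close>
    then have "?\<phi> dvd coeff (\<Phi> * G) (?d + 2 * n)"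
      using lead_coeff_dvd_coeff_mult[of \<Phi> G] \<Phi>(2) by simp
    moreover have "coeff T (?d + 2 * n) = 0"
      using deg(2) False by (intro coeff_eq_0) linarith
    ultimately have "?\<phi> dvd lead_coeff f * (coeff L n)\<^sup>2"
      using coeff_mult_add[OF le_refl L2(1), of f] by (simp add: L2(2) flip: G)
    then obtain h where h: "lead_coeff f = ?\<phi> * h" using cancel by blast
    have "lead_coeff f \<noteq> 0" using False by auto
    then have h0: "h \<noteq> 0" "?\<phi> \<noteq> 0" using h by auto
    have "degree (lead_coeff f) \<le> ?d" using less.prems(1) by (auto simp: graded_polys_def)
    then have d3: "3 + degree h \<le> ?d" using h h0 \<Phi>(3) by (simp add: degree_mult_eq)
    \<comment> \<open>Subtracting \<open>\<Phi> * M\<close> preserves \<open>f\<close> modulo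
      \<open>\<Phi>\<close> and removes its top form; the bound \<open>d3\<close> puts
      \<open>M\<close> into the graded ring.\<close>
    define M where "M = monom h (?d - 3)"
    have M: "M \<in> graded_polys" "degree M = ?d - 3" "coeff M (?d - 3) = h"
      using d3 h0 by (auto simp: M_def graded_polys_def degree_monom_eq)
    define f' where "f' = f - \<Phi> * M"
    have "f' \<in> graded_polys"
      unfolding f'_def by (intro subring_diff[OF B] subring_mult[OF B] \<Phi> M less.prems)
    moreover have "\<Phi> dvd T - f' * L\<^sup>2"
    proof -
      have "T - f' * L\<^sup>2 = \<Phi> * (G + M * L\<^sup>2)" using G by (simp add: f'_def algebra_simps)
      then show ?thesis by simp
    qed
    moreover have "degree f' < ?d"
    proof (rule degree_lessI)
      have "degree (\<Phi> * M) \<le> ?d" using degree_mult_le[of \<Phi> M] \<Phi>(2) M(2) d3 by linarith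
      then have le: "degree f' \<le> ?d" unfolding f'_def by (intro degree_diff_le) auto
      have "coeff (\<Phi> * M) (3 + (?d - 3)) = ?\<phi> * h"
        using \<Phi>(2) M(2,3) by (subst coeff_mult_add) auto
      then have "coeff f' ?d = 0" using d3 h by (simp add: f'_def)
      then show "\<forall>k\<ge>?d. coeff f' k = 0" using le by (metis coeff_eq_0 le_neq_implies_less le_trans not_le)
    qed (use False in auto)
    ultimately show ?thesis using less.hyps by blast
  qed
qed

section \<open>Congruences, degrees and expansions for the cubic\<close>

lemma cubic_rotate: "cubic a1 a2 a0 b1 b2 b0 s x y z = cubic a0 a1 a2 b0 b1 b2 s z x y"
  by (simp add: cubic_def algebra_simps)

text \<open>The coordinates are replaced one after another. Congruences of coordinates modulo an
  ideal thus carry over to the cubic.\<close>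

lemma cubic_diff:
  "cubic a0 a1 a2 b0 b1 b2 s x y z - cubic a0 a1 a2 b0 b1 b2 s x' y' z' =
     (x - x') * (b0 * (x + x') * z + a1 * z\<^sup>2 + b1 * y\<^sup>2 + a2 * (x + x') * y - s * y * z) +
     (y - y') * (a0 * (y + y') * z + b1 * (y + y') * x' + a2 * x'\<^sup>2 + b2 * z\<^sup>2 - s * x' * z) +
     (z - z') * (a0 * y'\<^sup>2 + b0 * x'\<^sup>2 + a1 * (z + z') * x' + b2 * (z + z') * y' - s * x' * y')"
  by (simp add: cubic_def algebra_simps power2_eq_square)

text \<open>Evaluation at \<open>w\<close>, \<open>w1\<close>, \<open>w2\<close> applies a
  Vandermonde matrix of determinant \<open>D\<close> to (1, u, v). Its transpose sends the cross
  product of two images to \<open>D\<close> times the cross product of the original vectors; these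
  are two of the three entries.\<close>

lemma cross_coordinates:
  fixes u v u' v' w w1 w2 :: "'r::comm_ring_1"
  defines "x \<equiv> \<lambda>w. 1 + u * w + v * w\<^sup>2" and "x' \<equiv> \<lambda>w. 1 + u' * w + v' * w\<^sup>2"
    and "D \<equiv> (w1 - w) * (w2 - w) * (w2 - w1)"
  shows "w\<^sup>2 * (x w1 * x' w2 - x' w1 * x w2) + w1\<^sup>2 * (x w2 * x' w - x' w2 * x w) +
      w2\<^sup>2 * (x w * x' w1 - x' w * x w1) = D * (u' - u)"
    and "w * (x w1 * x' w2 - x' w1 * x w2) + w1 * (x w2 * x' w - x' w2 * x w) +
      w2 * (x w * x' w1 - x' w * x w1) = - D * (v' - v)"
  unfolding x_def x'_def D_def power2_eq_square by (simp_all add: algebra_simps)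

text \<open>By pigeonhole, every monomial of degree 4 in three variables contains a square.\<close>

lemma ideal_sum_power4:
  assumes B: "is_subring B" and I: "ideal_of B I" and "r \<in> B" "t \<in> B" "v \<in> B"
    and "r\<^sup>2 \<in> I" "t\<^sup>2 \<in> I" "v\<^sup>2 \<in> I"
  shows "(r + t + v) ^ 4 \<in> I"
proof -
  have "(r + t + v) ^ 4 = ((r + 3 * t) * (r + t + 4 * v)) * r\<^sup>2 + ((3 * r + t) * (r + t + 4 * v)) * t\<^sup>2 +
      (6 * (r + t)\<^sup>2 + 4 * (r + t) * v + v\<^sup>2) * v\<^sup>2"
    by (simp add: power2_eq_square power4_eq_xxxx algebra_simps)
  also have "\<dots> \<in> I"
    by (intro ideal_add[OF B I] ideal_mult[OF B I] subring_add[OF B] subring_mult[OF B]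
        subring_power[OF B] subring_numeral[OF B] assms)
  finally show ?thesis .
qed

text \<open>The top coefficient of a cubic along a line is its value at the direction vector. This
  serves both for the variable u and for t.\<close>

lemma cubic_linear:
  "\<exists>c0 c1 c2. cubic [:a0:] [:a1:] [:a2:] [:b0:] [:b1:] [:b2:] [:s:] [:u0, u1:] [:v0, v1:] [:t0, t1:] =
    [:c0, c1, c2, cubic a0 a1 a2 b0 b1 b2 s u1 v1 t1:]"
  by (simp add: cubic_def power2_eq_square; (simp add: algebra_simps)?)

lemma poly_cubic: "poly (cubic a0 a1 a2 b0 b1 b2 s x y z) t =
  cubic (poly a0 t) (poly a1 t) (poly a2 t) (poly b0 t) (poly b1 t) (poly b2 t) (poly s t)
    (poly x t) (poly y t) (poly z t)"
  by (simp add: cubic_def)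

lemma poly_wp_num: "poly (wp_num a0 a1 a2 b0 b1 b2 s x y z x' y' z') t =
  wp_num (poly a0 t) (poly a1 t) (poly a2 t) (poly b0 t) (poly b1 t) (poly b2 t) (poly s t)
    (poly x t) (poly y t) (poly z t) (poly x' t) (poly y' t) (poly z' t)"
  by (simp add: wp_num_def)

lemma degree_mult_le': "degree p \<le> m \<Longrightarrow> degree r \<le> n \<Longrightarrow> m + n \<le> k \<Longrightarrow> degree (p * r) \<le> k"
  using degree_mult_le[of p r] by linarith

text \<open>\<open>wp_num\<close> is a form of degree 2 in each of the two points.\<close>

lemma degree_wp_num:
  fixes x :: "'r::idom poly"
  assumes "degree a0 = 0" "degree a1 = 0" "degree a2 = 0" "degree b0 = 0" "degree b1 = 0" "degree b2 = 0"
    "degree s = 0"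
    and x: "degree x \<le> k" "degree y \<le> k" "degree z \<le> k"
    and x': "degree x' \<le> l" "degree y' \<le> l" "degree z' \<le> l"
  shows "degree (wp_num a0 a1 a2 b0 b1 b2 s x y z x' y' z') \<le> 2 * (k + l)"
proof -
  note mult = degree_mult_le'
  have const: "degree (c * p) \<le> n" if "degree c = 0" "degree p \<le> n" for c p :: "'r poly" and n
    using that by (intro mult[of c 0 p n]) auto
  have lin: "degree (a1 * x + b2 * y) \<le> k" if "degree x \<le> k" "degree y \<le> k" for x y k
    using that assms by (intro degree_add_le const)
  have quad: "degree (a0 * y\<^sup>2 + b0 * x\<^sup>2 - s * x * y + z * (a1 * x + b2 * y)) \<le> 2 * k"
    if "degree x \<le> k" "degree y \<le> k" "degree z \<le> k" for x y z k
  proof -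
    have "degree (b0 * x\<^sup>2) \<le> 2 * k" "degree (a0 * y\<^sup>2) \<le> 2 * k"
      using that assms mult[of x k x k "2 * k"] mult[of y k y k "2 * k"]
      by (auto simp: power2_eq_square intro!: const)
    moreover have "degree (s * x * y) \<le> 2 * k"
      using that assms const[of s x k] by (intro mult[of "s * x" k y k]) auto
    moreover have "degree (z * (a1 * x + b2 * y)) \<le> 2 * k"
      using that lin[of x k y] by (intro mult[of z k _ k]) auto
    ultimately show ?thesis by (intro degree_add_le degree_diff_le)
  qed
  have sum: "degree (x * y' + x' * y) \<le> k + l"
    using x x' by (intro degree_add_le mult[of x k y' l] mult[of x' l y k]) auto
  have coeffs0: "degree (a1 * a2) = 0" "degree (b1 * b2) = 0" "degree (2 * (a1 * b1 + a2 * b2)) = 0"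
    using assms mult[of a1 0 a2 0 0] mult[of b1 0 b2 0 0]
      const[of 2 "a1 * b1 + a2 * b2" 0] degree_add_le[of "a1 * b1" 0 "a2 * b2"]
      mult[of a1 0 b1 0 0] mult[of a2 0 b2 0 0] by auto
  have cross: "degree (c * u * v * r) \<le> k + l + n"
    if "degree c = 0" "degree u \<le> k" "degree v \<le> l" "degree r \<le> n" for c u v r :: "'r poly" and n
    using that const[of c u k] mult[of "c * u" k v l "k + l"]
    by (intro mult[of "c * u * v" "k + l" r n]) auto
  have "degree ((a0 * y\<^sup>2 + b0 * x\<^sup>2 - s * x * y + z * (a1 * x + b2 * y)) *
     (a0 * y'\<^sup>2 + b0 * x'\<^sup>2 - s * x' * y' + z' * (a1 * x' + b2 * y'))) \<le> 2 * (k + l)"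
    using quad[OF x] quad[OF x'] by (rule mult) simp
  moreover have "degree (z * z' * (a1 * x + b2 * y) * (a1 * x' + b2 * y')) \<le> 2 * (k + l)"
    using mult[OF mult[OF mult[OF x(3) x'(3) order_refl] lin[OF x(1,2)] order_refl] lin[OF x'(1,2)] order_refl]
    by simp
  moreover have "degree (a1 * a2 * x * x' * (x * y' + x' * y)) \<le> 2 * (k + l)"
    using cross[OF coeffs0(1) x(1) x'(1) sum] by simp
  moreover have "degree (b1 * b2 * y * y' * (x * y' + x' * y)) \<le> 2 * (k + l)"
    using cross[OF coeffs0(2) x(2) x'(2) sum] by simp
  moreover have "degree (2 * (a1 * b1 + a2 * b2) * x * x' * y * y') \<le> 2 * (k + l)"
    using mult[OF cross[OF coeffs0(3) x(1) x'(1) x(2)] x'(2) order_refl] by simp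
  ultimately show ?thesis
    unfolding wp_num_def by (intro degree_add_le degree_diff_le)
qed

text \<open>The gradient of the cubic at (1, 0, 0) is (0, \<open>a2\<close>,
  \<open>b0\<close>).\<close>

lemma pderiv_cubic_at:
  fixes x y z :: "'r::idom poly"
  assumes "poly y t = 0" "poly z t = 0"
  shows "poly (pderiv (cubic [:a0:] [:a1:] [:a2:] [:b0:] [:b1:] [:b2:] [:s:] x y z)) t =
    (poly x t)\<^sup>2 * (a2 * poly (pderiv y) t + b0 * poly (pderiv z) t)"
  using assms
  by (simp add: cubic_def power2_eq_square pderiv_add pderiv_diff pderiv_mult pderiv_smult algebra_simps)

text \<open>First-order expansion at the pair (1, 0, 0), (0, 1, 0), up to scaling. The second point
  is stationary because it will consist of q-th powers.\<close>

lemma wp_num_at: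
  fixes x y z x' y' z' :: "'r::idom poly"
  assumes "poly y t = 0" "poly z t = 0" "poly x' t = 0" "poly z' t = 0"
    and "pderiv x' = 0" "pderiv y' = 0" "pderiv z' = 0"
  shows "poly (wp_num [:a0:] [:a1:] [:a2:] [:b0:] [:b1:] [:b2:] [:s:] x y z x' y' z') t =
      a0 * b0 * (poly x t)\<^sup>2 * (poly y' t)\<^sup>2" (is ?value)
    and "poly (pderiv (wp_num [:a0:] [:a1:] [:a2:] [:b0:] [:b1:] [:b2:] [:s:] x y z x' y' z')) t =
      (poly y' t)\<^sup>2 * poly x t *
        (2 * a0 * b0 * poly (pderiv x) t - (a0 * s + b1 * b2) * poly (pderiv y) t + a0 * a1 * poly (pderiv z) t)"
      (is ?deriv)
proof -
  show ?value using assms by (simp add: wp_num_def power2_eq_square algebra_simps)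
  show ?deriv
    using assms unfolding wp_num_def power2_eq_square
    by (simp add: pderiv_add pderiv_diff pderiv_mult pderiv_smult) (simp add: algebra_simps)
qed

section \<open>Cubics without rational points\<close>

text \<open>Conjugate coefficients make the cubic a form over F_q when it is read in the coordinates
  (c, c^q, c^(q^2)). In the application, \<open>norm\<close> compares N(a z) with N(a z^q).\<close>

locale pointless_cubic =
  fixes q n :: nat and a0 a1 a2 b0 b1 b2 s w w1 w2 :: "'a::{field,finite}"
  assumes char: "prime CHAR('a)" "q = CHAR('a) ^ n" and odd_q: "odd q" and q2: "q \<ge> 2"
    and a: "a0 ^ q = a1" "a1 ^ q = a2" "a2 ^ q = a0"
    and b: "b0 ^ q = b1" "b1 ^ q = b2" "b2 ^ q = b0"
    and s: "s ^ q = s"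
    and w: "w ^ q = w1" "w1 ^ q = w2" "w2 ^ q = w" "w \<noteq> w1"
    and card_fixed: "card {x :: 'a. x ^ q = x} = q"
    and pointless: "\<And>c. c \<noteq> 0 \<Longrightarrow> cubic a0 a1 a2 b0 b1 b2 s c (c ^ q) ((c ^ q) ^ q) \<noteq> 0"
    and norm: "a0 * a1 * a2 = b0 * b1 * b2" and a0: "a0 \<noteq> 0" and b0: "b0 \<noteq> 0"
begin

abbreviation "C c \<equiv> [:[:c :: 'a:]:]"

text \<open>
  A rational point is \<open>(c, c\<^sup>q, c\<^sup>q\<^sup>q)\<close>. Here \<open>c = 1 + u w + v w\<^sup>2\<close> with affine coordinates \<open>u, v\<close>, and \<open>coord'\<close>
  yields the image of the point under Frobenius.
\<close>
definition U :: "'a poly poly" where "U = [:0, 1:]"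
definition V :: "'a poly poly" where "V = [:0, [:0, 1:]:]"

definition coord :: "'a \<Rightarrow> 'a poly poly" where "coord t = 1 + U * C t + V * C (t\<^sup>2)"
definition coord' :: "'a \<Rightarrow> 'a poly poly" where "coord' t = 1 + U ^ q * C t + V ^ q * C (t\<^sup>2)"

definition \<Phi> :: "'a poly poly" where
  "\<Phi> = cubic (C a0) (C a1) (C a2) (C b0) (C b1) (C b2) (C s) (coord w) (coord w1) (coord w2)"

text \<open>The entries of the cross product of the generic point and its Frobenius image.
  \<open>T1\<close>, \<open>T2\<close>, \<open>T3\<close> are the numerators over the squares of the
  entries with the same index, one for each coordinate vector e.\<close>

definition L1 where "L1 = coord w1 * coord' w2 - coord' w1 * coord w2"
definition L2 where "L2 = coord w2 * coord' w - coord' w2 * coord w"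
definition L3 where "L3 = coord w * coord' w1 - coord' w * coord w1"

definition T1 where "T1 = wp_num (C a1) (C a2) (C a0) (C b1) (C b2) (C b0) (C s)
  (coord w1) (coord w2) (coord w) (coord' w1) (coord' w2) (coord' w)"
definition T2 where "T2 = wp_num (C a2) (C a0) (C a1) (C b2) (C b0) (C b1) (C s)
  (coord w2) (coord w) (coord w1) (coord' w2) (coord' w) (coord' w1)"
definition T3 where "T3 = wp_num (C a0) (C a1) (C a2) (C b0) (C b1) (C b2) (C s)
  (coord w) (coord w1) (coord w2) (coord' w) (coord' w1) (coord' w2)"

section \<open>Frobenius on the generic point\<close>

lemma frob_add: "(x + y) ^ q = x ^ q + y ^ q" for x y :: 'a
  by (rule freshmans_dream'[OF char])

lemma frob_minus: "(- x) ^ q = - (x ^ q)" for x :: "'b::comm_ring_1"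
  using odd_q by simp

lemma frob_poly_add: "(x + y) ^ q = x ^ q + y ^ q" for x y :: "'a poly poly"
  using freshmans_dream'[of q n x y] char by simp

lemma frob_poly_diff: "(x - y) ^ q = x ^ q - y ^ q" for x y :: "'a poly poly"
  using frob_poly_add[of x "- y"] frob_minus[of y] by simp

lemma C_add: "C (x + y) = C x + C y" and C_mult: "C (x * y) = C x * C y"
  and C_diff: "C (x - y) = C x - C y" and C_one: "C 1 = 1" and C_power: "C x ^ k = C (x ^ k)"
  by (simp_all add: poly_const_pow one_pCons)

lemma C_cubic: "C (cubic u0 u1 u2 v0 v1 v2 r x y z) =
    cubic (C u0) (C u1) (C u2) (C v0) (C v1) (C v2) (C r) (C x) (C y) (C z)"
  by (simp only: cubic_def C_add C_mult C_diff power2_eq_square)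

lemma coord_frob: "coord t ^ q = coord' (t ^ q)"
proof -
  have "C (t\<^sup>2) ^ q = C ((t ^ q)\<^sup>2)" by (simp add: C_power power_commutes flip: power_mult) (simp add: mult.commute)
  then show ?thesis
    unfolding coord_def coord'_def frob_poly_add power_mult_distrib C_power by (simp add: C_power)
qed

text \<open>Frobenius shifts coefficients and coordinates cyclically, and the cubic is invariant
  under this shift. Hence the image of a point of the curve lies on the curve.\<close>

lemma \<Phi>_frob: "\<Phi> ^ q = cubic (C a0) (C a1) (C a2) (C b0) (C b1) (C b2) (C s)
    (coord' w) (coord' w1) (coord' w2)"
proof -
  have sq: "(x\<^sup>2) ^ q = (x ^ q)\<^sup>2" for x :: "'a poly poly" by (simp add: mult.commute flip: power_mult)
  have "\<Phi> ^ q = cubic (C a1) (C a2) (C a0) (C b1) (C b2) (C b0) (C s)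
    (coord' w1) (coord' w2) (coord' w)"
    unfolding \<Phi>_def cubic_def frob_poly_add frob_poly_diff power_mult_distrib sq coord_frob C_power a b s w ..
  then show ?thesis by (simp add: cubic_rotate)
qed

text \<open>Modulo \<open>\<Phi>\<close> both points lie on the curve, so the three local
  expressions of the function agree.\<close>

lemma \<Phi>_dvd: "\<Phi> dvd T3 * L1\<^sup>2 - T1 * L3\<^sup>2" "\<Phi> dvd T1 * L2\<^sup>2 - T2 * L1\<^sup>2" "\<Phi> dvd T2 * L3\<^sup>2 - T3 * L2\<^sup>2"
proof -
  have F': "\<Phi> dvd cubic (C a0) (C a1) (C a2) (C b0) (C b1) (C b2) (C s) (coord' w) (coord' w1) (coord' w2)"
    unfolding \<Phi>_frob[symmetric] using q2 by (intro dvd_power) auto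
  have F: "\<Phi> dvd cubic (C a0) (C a1) (C a2) (C b0) (C b1) (C b2) (C s) (coord w) (coord w1) (coord w2)"
    by (simp add: \<Phi>_def)
  have rot: "cubic u1 u2 u0 v1 v2 v0 r y z x = cubic u0 u1 u2 v0 v1 v2 r x y z"
    "cubic u2 u0 u1 v2 v0 v1 r z x y = cubic u0 u1 u2 v0 v1 v2 r x y z"
    for u0 u1 u2 v0 v1 v2 r x y z :: "'a poly poly"
    by (simp_all add: cubic_rotate)
  show "\<Phi> dvd T3 * L1\<^sup>2 - T1 * L3\<^sup>2"
    unfolding T3_def T1_def L1_def L3_def wp_num_identity
    using F F' by (intro dvd_add dvd_mult2)
  show "\<Phi> dvd T1 * L2\<^sup>2 - T2 * L1\<^sup>2"
    unfolding T2_def T1_def L1_def L2_def wp_num_identity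
    using F F' by (intro dvd_add dvd_mult2) (simp_all only: rot)
  show "\<Phi> dvd T2 * L3\<^sup>2 - T3 * L2\<^sup>2"
    unfolding T2_def T3_def L3_def L2_def wp_num_identity
    using F F' by (intro dvd_add dvd_mult2) (simp_all only: rot)
qed

lemma two_nz: "(2 :: 'a) \<noteq> 0"
proof
  assume "(2 :: 'a) = 0"
  then have "CHAR('a) dvd 2" using of_nat_eq_0_iff_char_dvd[where ?'a = 'a, of 2] by simp
  then have "CHAR('a) = 2" using char(1) by (metis primes_dvd_imp_eq two_is_prime_nat)
  then show False using char(2) odd_q q2 by (cases n) auto
qed

lemma w_distinct: "w1 \<noteq> w2" "w2 \<noteq> w" "w \<noteq> 0" "w1 \<noteq> 0" "w2 \<noteq> 0" "w1 + w2 \<noteq> 0"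
proof -
  show 12: "w1 \<noteq> w2" using w by metis
  show "w2 \<noteq> w" using w by metis
  have z: "(0::'a) ^ q = 0" using q2 by simp
  show "w \<noteq> 0" "w1 \<noteq> 0" "w2 \<noteq> 0" using w z by metis+
  show "w1 + w2 \<noteq> 0"
  proof
    assume "w1 + w2 = 0"
    then have w2: "w2 = - w1" by (simp add: add_eq_0_iff)
    have "w = (- w1) ^ q" using w(3) w2 by simp
    also have "\<dots> = - w2" using w(2) frob_minus[of w1] by simp
    finally show False using w(4) w2 by simp
  qed
qed

lemma graded:
  "C c \<in> graded_polys" "U \<in> graded_polys" "V \<in> graded_polys" "coord t \<in> graded_polys"
  "coord' t \<in> graded_polys" "\<Phi> \<in> graded_polys" "L1 \<in> graded_polys" "L2 \<in> graded_polys"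
  "L3 \<in> graded_polys" "T1 \<in> graded_polys" "T2 \<in> graded_polys" "T3 \<in> graded_polys"
proof -
  note B = is_subring_graded_polys
  note rules = subring_add[OF B] subring_mult[OF B] subring_diff[OF B] subring_power[OF B]
    subring_one[OF B] subring_numeral[OF B]
  show C: "C c \<in> graded_polys" for c by (auto simp: graded_polys_def coeff_pCons split: nat.splits)
  show U: "U \<in> graded_polys" and V: "V \<in> graded_polys"
    by (auto simp: U_def V_def graded_polys_def coeff_pCons split: nat.splits)
  show coord: "coord t \<in> graded_polys" "coord' t \<in> graded_polys" for t
    unfolding coord_def coord'_def by (intro rules C U V)+
  show "\<Phi> \<in> graded_polys" "L1 \<in> graded_polys" "L2 \<in> graded_polys"
    "L3 \<in> graded_polys" "T1 \<in> graded_polys" "T2 \<in> graded_polys" "T3 \<in> graded_polys"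
    unfolding \<Phi>_def L1_def L2_def L3_def T1_def T2_def T3_def cubic_def wp_num_def
    by (intro rules C coord)+
qed

text \<open>The ideal of denominators of the function composed with \<open>P \<mapsto> (P, \<pi> P)\<close>.\<close>
definition denominators :: "'a poly poly set" where
  "denominators = {g \<in> graded_polys. \<exists>h\<in>graded_polys.
     \<Phi> dvd g * T1 - h * L1\<^sup>2 \<and> \<Phi> dvd g * T2 - h * L2\<^sup>2 \<and> \<Phi> dvd g * T3 - h * L3\<^sup>2}"

lemma ideal_denominators: "ideal_of graded_polys denominators"
proof -
  note B = is_subring_graded_polys
  have sum: "\<Phi> dvd (g + g') * T - (h + h') * L" if "\<Phi> dvd g * T - h * L" "\<Phi> dvd g' * T - h' * L"
    for g g' h h' T L
  proof -
    have "(g + g') * T - (h + h') * L = (g * T - h * L) + (g' * T - h' * L)" by (simp add: algebra_simps)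
    then show ?thesis using that by (simp only: dvd_add)
  qed
  have mult: "\<Phi> dvd (b * g) * T - (b * h) * L" if "\<Phi> dvd g * T - h * L" for g h T L b
  proof -
    have "(b * g) * T - (b * h) * L = b * (g * T - h * L)" by (simp add: algebra_simps)
    then show ?thesis using that by (simp only: dvd_mult)
  qed
  show ?thesis
    unfolding ideal_of_def
  proof (intro conjI ballI)
    show "0 \<in> denominators" unfolding denominators_def using subring_zero[OF B] by (auto intro!: bexI[of _ 0])
  next
    fix x y assume "x \<in> denominators" "y \<in> denominators"
    then show "x + y \<in> denominators" unfolding denominators_def using sum subring_add[OF B] by blast
  next
    fix b x :: "'a poly poly" assume "b \<in> graded_polys" "x \<in> denominators"
    then show "b * x \<in> denominators" unfolding denominators_def using mult subring_mult[OF B] by blast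
  qed
qed

text \<open>Because the local expressions agree, each squared entry clears the poles of all three,
  with the matching \<open>T1\<close>, \<open>T2\<close> or \<open>T3\<close> as numerator;
  \<open>\<Phi>\<close> does so with numerator 0.\<close>

lemma in_denominators: "\<Phi> \<in> denominators" "L1\<^sup>2 \<in> denominators" "L2\<^sup>2 \<in> denominators" "L3\<^sup>2 \<in> denominators"
proof -
  note B = is_subring_graded_polys
  show "\<Phi> \<in> denominators" unfolding denominators_def using graded(6) subring_zero[OF B] by (auto intro!: bexI[of _ 0])
  have swap: "\<Phi> dvd y - x" if "\<Phi> dvd x - y" for x y
    using that by (metis dvd_minus_iff minus_diff_eq)
  have rel: "\<Phi> dvd L1\<^sup>2 * T3 - T1 * L3\<^sup>2" "\<Phi> dvd L3\<^sup>2 * T1 - T3 * L1\<^sup>2"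
    "\<Phi> dvd L2\<^sup>2 * T1 - T2 * L1\<^sup>2" "\<Phi> dvd L1\<^sup>2 * T2 - T1 * L2\<^sup>2"
    "\<Phi> dvd L3\<^sup>2 * T2 - T3 * L2\<^sup>2" "\<Phi> dvd L2\<^sup>2 * T3 - T2 * L3\<^sup>2"
    using \<Phi>_dvd \<Phi>_dvd[THEN swap] by (simp_all only: mult.commute)
  have triv: "\<Phi> dvd L * T - T * L" for L T by (simp add: mult.commute)
  show "L1\<^sup>2 \<in> denominators" unfolding denominators_def using rel triv graded subring_power[OF B] by blast
  show "L2\<^sup>2 \<in> denominators" unfolding denominators_def using rel triv graded subring_power[OF B] by blast
  show "L3\<^sup>2 \<in> denominators" unfolding denominators_def using rel triv graded subring_power[OF B] by blast
qed

section \<open>Absence of rational points in affine coordinates\<close>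

text \<open>Hypothesis \<open>pointless\<close> applies because 1 + \<alpha> X + \<beta> X^2 is
  nonzero at \<open>w\<close>: by Frobenius a zero there would give the three distinct zeros
  \<open>w\<close>, \<open>w1\<close>, \<open>w2\<close>.\<close>

lemma pointless_affine:
  assumes "\<alpha> ^ q = \<alpha>" "\<beta> ^ q = \<beta>"
  shows "cubic a0 a1 a2 b0 b1 b2 s (1 + \<alpha> * w + \<beta> * w\<^sup>2) (1 + \<alpha> * w1 + \<beta> * w1\<^sup>2) (1 + \<alpha> * w2 + \<beta> * w2\<^sup>2) \<noteq> 0"
proof -
  have sq: "(x\<^sup>2) ^ q = (x ^ q)\<^sup>2" for x :: 'a by (simp add: mult.commute flip: power_mult)
  have fr: "(1 + \<alpha> * w + \<beta> * w\<^sup>2) ^ q = 1 + \<alpha> * w1 + \<beta> * w1\<^sup>2"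
    "(1 + \<alpha> * w1 + \<beta> * w1\<^sup>2) ^ q = 1 + \<alpha> * w2 + \<beta> * w2\<^sup>2"
    by (simp_all add: frob_add power_mult_distrib sq assms w)
  have "1 + \<alpha> * w + \<beta> * w\<^sup>2 \<noteq> 0"
  proof
    assume 0: "1 + \<alpha> * w + \<beta> * w\<^sup>2 = 0"
    have z: "(0::'a) ^ q = 0" using q2 by simp
    have dist: "(y - x) * (\<alpha> + \<beta> * (x + y)) = (1 + \<alpha> * y + \<beta> * y\<^sup>2) - (1 + \<alpha> * x + \<beta> * x\<^sup>2)" for x y
      by (simp add: algebra_simps power2_eq_square)
    have 1: "1 + \<alpha> * w1 + \<beta> * w1\<^sup>2 = 0" using fr(1) 0 z by simp
    have 2: "1 + \<alpha> * w2 + \<beta> * w2\<^sup>2 = 0" using fr(2) 1 z by simp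
    have "(w1 - w) * (\<alpha> + \<beta> * (w + w1)) = 0"
      using 0 1 dist[where x = w and y = w1] by (simp only: diff_self)
    then have 3: "\<alpha> + \<beta> * (w + w1) = 0" using w(4) by simp
    have "(w2 - w1) * (\<alpha> + \<beta> * (w1 + w2)) = 0"
      using 1 2 dist[where x = w1 and y = w2] by (simp only: diff_self)
    then have 4: "\<alpha> + \<beta> * (w1 + w2) = 0" using w_distinct(1) by simp
    have "\<beta> * (w2 - w) = (\<alpha> + \<beta> * (w1 + w2)) - (\<alpha> + \<beta> * (w + w1))" by (simp add: algebra_simps)
    then have "\<beta> * (w2 - w) = 0" using 3 4 by simp
    then have "\<beta> = 0" using w_distinct(2) by simp
    then show False using 3 0 by simp
  qed
  then show ?thesis using pointless[of "1 + \<alpha> * w + \<beta> * w\<^sup>2"] fr by simp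
qed

text \<open>The points (0 : 1 : \<beta>) of the line at infinity; its remaining rational point (0 :
  0 : 1) is treated next.\<close>

lemma pointless_infinity:
  assumes "\<beta> ^ q = \<beta>"
  shows "cubic a0 a1 a2 b0 b1 b2 s (w + \<beta> * w\<^sup>2) (w1 + \<beta> * w1\<^sup>2) (w2 + \<beta> * w2\<^sup>2) \<noteq> 0"
proof -
  have sq: "(x\<^sup>2) ^ q = (x ^ q)\<^sup>2" for x :: 'a by (simp add: mult.commute flip: power_mult)
  have fr: "(w + \<beta> * w\<^sup>2) ^ q = w1 + \<beta> * w1\<^sup>2" "(w1 + \<beta> * w1\<^sup>2) ^ q = w2 + \<beta> * w2\<^sup>2"
    by (simp_all add: frob_add power_mult_distrib sq assms w)
  have "w + \<beta> * w\<^sup>2 \<noteq> 0"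
  proof
    assume 0: "w + \<beta> * w\<^sup>2 = 0"
    have z: "(0::'a) ^ q = 0" using q2 by simp
    have "w1 + \<beta> * w1\<^sup>2 = 0" using fr(1) 0 z by simp
    then have "w1 * (1 + \<beta> * w1) = 0" "w * (1 + \<beta> * w) = 0" using 0 by (simp_all add: algebra_simps power2_eq_square)
    then have *: "1 + \<beta> * w1 = 0" "1 + \<beta> * w = 0" using w_distinct by auto
    have "\<beta> * (w1 - w) = (1 + \<beta> * w1) - (1 + \<beta> * w)" by (simp add: algebra_simps)
    then have "\<beta> * (w1 - w) = 0" using * by simp
    then show False using w(4) * by auto
  qed
  then show ?thesis using pointless[of "w + \<beta> * w\<^sup>2"] fr by simp
qed

lemma pointless_square: "cubic a0 a1 a2 b0 b1 b2 s (w\<^sup>2) (w1\<^sup>2) (w2\<^sup>2) \<noteq> 0"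
proof -
  have sq: "(x\<^sup>2) ^ q = (x ^ q)\<^sup>2" for x :: 'a by (simp add: mult.commute flip: power_mult)
  show ?thesis using pointless[of "w\<^sup>2"] w_distinct by (simp add: sq w)
qed

abbreviation "fixed_consts \<equiv> C ` {x. x ^ q = x}"

lemma fixed_prod: "r ^ q - r = (\<Prod>a\<in>fixed_consts. r - a)"
proof (rule frobenius_fixed_prod[OF _ _ _ q2])
  have "inj_on C A" for A by (auto intro: inj_onI)
  then show "card fixed_consts = q" by (simp add: card_image card_fixed)
  show "a ^ q = a" if "a \<in> fixed_consts" for a using that by (auto simp: poly_const_pow)
qed simp

text \<open>By \<open>cross_coordinates\<close>, u^q - u and v^q - v are combinations of
  \<open>L1\<close>, \<open>L2\<close>, \<open>L3\<close>, whose squares are denominators. So poles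
  can occur only where u and v lie in F_q.\<close>

lemma fixed_prod_in_denominators: "(\<Prod>a\<in>fixed_consts. U - a) ^ 4 \<in> denominators" "(\<Prod>a\<in>fixed_consts. V - a) ^ 4 \<in> denominators"
proof -
  note B = is_subring_graded_polys
  define D where "D = (w1 - w) * (w2 - w) * (w2 - w1)"
  have D0: "D \<noteq> 0" using w w_distinct by (auto simp: D_def)
  have C_D: "C D = (C w1 - C w) * (C w2 - C w) * (C w2 - C w1)"
    by (simp only: D_def C_diff C_mult)
  have co: "coord t = 1 + U * C t + V * (C t)\<^sup>2" "coord' t = 1 + U ^ q * C t + V ^ q * (C t)\<^sup>2" for t
    by (simp_all only: coord_def coord'_def C_power)
  have "(C w)\<^sup>2 * L1 + (C w1)\<^sup>2 * L2 + (C w2)\<^sup>2 * L3 = C D * (U ^ q - U)"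
    "C w * L1 + C w1 * L2 + C w2 * L3 = - C D * (V ^ q - V)"
    unfolding L1_def L2_def L3_def co C_D by (rule cross_coordinates)+
  then have eq: "C D * (U ^ q - U) = C (w\<^sup>2) * L1 + C (w1\<^sup>2) * L2 + C (w2\<^sup>2) * L3"
    "- C D * (V ^ q - V) = C w * L1 + C w1 * L2 + C w2 * L3"
    by (simp_all only: C_power)
  have sq_in: "(C c * L)\<^sup>2 \<in> denominators" if "L\<^sup>2 \<in> denominators" for c L
    unfolding power_mult_distrib by (intro ideal_mult[OF B ideal_denominators] subring_power[OF B] graded that)
  have comb: "(C c1 * L1 + C c2 * L2 + C c3 * L3) ^ 4 \<in> denominators" for c1 c2 c3
    by (intro ideal_sum_power4[OF B ideal_denominators] sq_in subring_mult[OF B] graded in_denominators)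
  have scale: "r ^ 4 \<in> denominators" if "(C c * r) ^ 4 \<in> denominators" "c \<noteq> 0" for c r
  proof -
    have "C (inverse c ^ 4) * (C c * r) ^ 4 = C (inverse c ^ 4 * c ^ 4) * r ^ 4"
      by (simp only: power_mult_distrib C_power C_mult mult.assoc)
    also have "inverse c ^ 4 * c ^ 4 = 1" using that(2) by (simp flip: power_mult_distrib)
    also have "C 1 * r ^ 4 = r ^ 4" by (simp only: C_one mult_1)
    finally show ?thesis using ideal_mult[OF B ideal_denominators graded(1) that(1)] by metis
  qed
  have "(C D * (U ^ q - U)) ^ 4 \<in> denominators" unfolding eq(1) by (rule comb)
  then show "(\<Prod>a\<in>fixed_consts. U - a) ^ 4 \<in> denominators"
    unfolding fixed_prod[symmetric] by (rule scale[OF _ D0])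
  have "- C D = C (- D)" by simp
  then have eq': "C (- D) * (V ^ q - V) = C w * L1 + C w1 * L2 + C w2 * L3" using eq(2) by (simp only:)
  have "(C (- D) * (V ^ q - V)) ^ 4 \<in> denominators" unfolding eq' by (rule comb)
  then show "(\<Prod>a\<in>fixed_consts. V - a) ^ 4 \<in> denominators"
    unfolding fixed_prod[symmetric] by (rule scale) (use D0 in simp)
qed

text \<open>Modulo u - \<alpha> and v - \<beta>, the denominator \<open>\<Phi>\<close> is congruent
  to its value at a rational point, a nonzero constant. This excludes every candidate pole.\<close>

lemma one_in_denominators: "1 \<in> denominators"
proof (rule ideal_one_of_local[OF is_subring_graded_polys ideal_denominators _ _ _ _ fixed_prod_in_denominators])
  show "finite fixed_consts" by simp
  show "fixed_consts \<subseteq> graded_polys" "U \<in> graded_polys" "V \<in> graded_polys" using graded by auto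
next
  note B = is_subring_graded_polys
  fix J a b
  assume J: "ideal_of graded_polys J" "denominators \<subseteq> J" and ab: "a \<in> fixed_consts" "b \<in> fixed_consts"
    and UV: "U - a \<in> J" "V - b \<in> J"
  obtain \<alpha> \<beta> where \<alpha>: "a = C \<alpha>" "\<alpha> ^ q = \<alpha>" and \<beta>: "b = C \<beta>" "\<beta> ^ q = \<beta>" using ab by auto
  define c where "c = (\<lambda>t. 1 + \<alpha> * t + \<beta> * t\<^sup>2)"
  have cong: "coord t - C (c t) \<in> J" for t
  proof -
    have "C (c t) = 1 + C \<alpha> * C t + C \<beta> * C (t\<^sup>2)" by (simp only: c_def C_add C_mult C_one)
    then have "coord t - C (c t) = (U - a) * C t + (V - b) * C (t\<^sup>2)"
      unfolding coord_def \<alpha> \<beta> by (simp only: algebra_simps)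
    then show ?thesis
      using ideal_add[OF B J(1) ideal_mult2[OF B J(1) graded(1) UV(1)] ideal_mult2[OF B J(1) graded(1) UV(2)]]
      by simp
  qed
  define k where "k = cubic a0 a1 a2 b0 b1 b2 s (c w) (c w1) (c w2)"
  have k0: "k \<noteq> 0" unfolding k_def c_def using pointless_affine \<alpha> \<beta> by blast
  have "\<Phi> - C k \<in> J"
    unfolding \<Phi>_def k_def C_cubic cubic_diff
    by (intro ideal_add[OF B J(1)] ideal_mult2[OF B J(1)] cong
        subring_add[OF B] subring_mult[OF B] subring_diff[OF B] subring_power[OF B] graded)
  moreover have "\<Phi> \<in> J" using in_denominators(1) J(2) by blast
  ultimately have "\<Phi> - (\<Phi> - C k) \<in> J" using ideal_diff[OF B J(1)] by blast
  then have "C k \<in> J" by simp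
  then have "C (inverse k) * C k \<in> J" using ideal_mult[OF B J(1) graded(1)] by blast
  moreover have "C (inverse k) * C k = 1" using left_inverse[OF k0] by (simp only: C_one flip: C_mult)
  ultimately show "1 \<in> J" by simp
qed

lemma quotient_exists: "\<exists>f\<in>graded_polys. \<Phi> dvd T3 - f * L3\<^sup>2"
  using one_in_denominators unfolding denominators_def by auto

section \<open>The line at infinity\<close>

lemma coord_altdef: "coord t = [:1, [:t, t\<^sup>2:]:]"
  by (simp add: coord_def U_def V_def one_pCons)

lemma coord'_altdef: "coord' t = 1 + monom ([:t:] + monom (t\<^sup>2) q) q"
proof -
  have "U ^ q = monom 1 q" by (simp add: U_def monom_altdef)
  moreover have V: "V = [:[:0, 1:]:] * U" by (simp add: U_def V_def)
  have "V ^ q = [:[:0, 1:]:] ^ q * U ^ q" unfolding V by (rule power_mult_distrib)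
  then have "V ^ q = monom (monom 1 q) q"
    by (simp add: U_def poly_const_pow monom_altdef)
  ultimately show ?thesis by (simp add: coord'_def smult_monom add_monom mult.commute flip: add_monom)
qed

text \<open>The cubic restricted to the line at infinity, in the parameter t = v / u.\<close>

definition \<phi> where "\<phi> = cubic [:a0:] [:a1:] [:a2:] [:b0:] [:b1:] [:b2:] [:s:] [:w, w\<^sup>2:] [:w1, w1\<^sup>2:] [:w2, w2\<^sup>2:]"

lemma degree_\<phi>: "degree \<phi> = 3"
proof -
  obtain c0 c1 c2 where "\<phi> = [:c0, c1, c2, cubic a0 a1 a2 b0 b1 b2 s (w\<^sup>2) (w1\<^sup>2) (w2\<^sup>2):]"
    unfolding \<phi>_def using cubic_linear by blast
  then show ?thesis using pointless_square by simp
qed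

lemma degree_\<Phi>: "degree \<Phi> = 3" "coeff \<Phi> 3 = \<phi>"
proof -
  obtain c0 c1 c2 where \<Phi>: "\<Phi> = [:c0, c1, c2, \<phi>:]"
    unfolding \<phi>_def \<Phi>_def coord_altdef using cubic_linear by blast
  have "\<phi> \<noteq> 0" using degree_\<phi> by auto
  then show "degree \<Phi> = 3" "coeff \<Phi> 3 = \<phi>" using \<Phi> by (simp_all add: numeral_3_eq_3)
qed

lemma degree_coord: "degree (coord t) \<le> 1" "coeff (coord t) 1 = [:t, t\<^sup>2:]"
  by (simp_all add: coord_altdef)

lemma degree_coord': "degree (coord' t) \<le> q" "coeff (coord' t) q = [:t:] + monom (t\<^sup>2) q"
  using q2 by (auto simp: coord'_altdef intro!: degree_add_le degree_monom_le)

lemma X_power_diff: "[:0, 1 :: 'a:] ^ q - [:0, 1:] = (\<Prod>b\<in>{x. x ^ q = x}. [:- b, 1:])"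
proof -
  have inj: "inj_on (\<lambda>b. [:b:]) A" for A :: "'a set" by (auto intro: inj_onI)
  have "[:0, 1 :: 'a:] ^ q - [:0, 1:] = (\<Prod>a\<in>(\<lambda>b. [:b:]) ` {x. x ^ q = x}. [:0, 1:] - a)"
    using card_fixed card_image[OF inj] q2
    by (intro frobenius_fixed_prod) (auto simp: poly_const_pow)
  then show ?thesis by (simp add: prod.reindex[OF inj])
qed

text \<open>As a polynomial in t, the top form of \<open>L3\<close> vanishes only at elements of
  F_q, where \<open>\<phi>\<close> has no zero.\<close>

lemma lead_L3: "coeff L3 (q + 1) = smult (w * w1 * (w1 - w)) ([:0, 1:] ^ q - [:0, 1:])"
proof -
  let ?X = "[:0, 1 :: 'a:]"
  have lin: "[:t, t\<^sup>2:] = [:t:] + [:t:]\<^sup>2 * ?X" "monom (t\<^sup>2) q = [:t:]\<^sup>2 * ?X ^ q" for t :: 'a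
    by (simp_all add: monom_altdef poly_const_pow)
  have "coeff L3 (1 + q) = [:w, w\<^sup>2:] * ([:w1:] + monom (w1\<^sup>2) q) - ([:w:] + monom (w\<^sup>2) q) * [:w1, w1\<^sup>2:]"
    unfolding L3_def coeff_diff
    by (simp only: coeff_mult_add[OF degree_coord(1) degree_coord'(1)] degree_coord degree_coord' mult.commute[of "coord' w"])
       (simp only: mult.commute)
  also have "\<dots> = [:w:] * [:w1:] * ([:w1:] - [:w:]) * (?X ^ q - ?X)"
    unfolding lin by (simp only: algebra_simps power2_eq_square)
  also have "\<dots> = smult (w * w1 * (w1 - w)) (?X ^ q - ?X)" by (simp add: mult_ac)
  finally show ?thesis by simp
qed

lemma quotient_const: "\<exists>c. \<Phi> dvd T3 - C c * L3\<^sup>2"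
proof -
  obtain f where f: "f \<in> graded_polys" "\<Phi> dvd T3 - f * L3\<^sup>2" using quotient_exists by blast
  show ?thesis
  proof (rule quotient_constant[OF graded(6) degree_\<Phi>(1) _ _ _ _ f])
    show "degree (coeff \<Phi> 3) = 3" using degree_\<Phi> degree_\<phi> by simp
    show "degree L3 \<le> q + 1"
      unfolding L3_def using degree_coord degree_coord'
      by (intro degree_diff_le degree_mult_le'[of _ 1 _ q] degree_mult_le'[of _ q _ 1]) auto
    show "degree T3 \<le> 2 * (q + 1)"
      unfolding T3_def add.commute[of q 1]
      by (rule degree_wp_num) (simp_all add: degree_coord(1)[simplified] degree_coord'(1))
  next
    \<comment> \<open>By \<open>pointless_infinity\<close>, \<open>\<phi>\<close> has no root in
      F_q, so both copies of the product of linear factors cancel.\<close>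
    fix g assume dvd: "coeff \<Phi> 3 dvd g * (coeff L3 (q + 1))\<^sup>2"
    define P where "P = (\<Prod>b\<in>{x. x ^ q = x}. [:- b, 1 :: 'a:])"
    have \<phi>: "poly \<phi> b \<noteq> 0" if "b \<in> {x. x ^ q = x}" for b
      unfolding \<phi>_def poly_cubic using pointless_infinity[of b] that
      by (simp add: algebra_simps)
    note cancel = dvd_mult_split_cancel[OF _ \<phi>, of "{x. x ^ q = x}", folded P_def]
    have "g * (coeff L3 (q + 1))\<^sup>2 = smult ((w * w1 * (w1 - w))\<^sup>2) (g * P * P)"
      unfolding lead_L3 X_power_diff P_def[symmetric] by (simp add: power2_eq_square mult.assoc)
    then have "\<phi> dvd g * P * P"
      using dvd w w_distinct degree_\<Phi> by (simp add: dvd_smult_iff)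
    then have "\<phi> dvd g * P" by (rule cancel[rotated 2]) simp_all
    then have "\<phi> dvd g" by (rule cancel[rotated 2]) simp_all
    then show "coeff \<Phi> 3 dvd g" using degree_\<Phi> by simp
  qed
qed

text \<open>The point (1, 0, 0) has Frobenius image (0, 1, 0), off the diagonal. There the values
  give \<open>c = a0 * b0\<close> and the derivatives a linear relation between dy and dz;
  comparison with the tangent equation yields the claim.\<close>

lemma pointless_relation: "s * a0 * b0 + 2 * (a0 * a1 * a2) = 0"
proof -
  obtain c where c: "\<Phi> dvd T3 - C c * L3\<^sup>2" using quotient_const by blast
  \<comment> \<open>Restrict to a conic through the point \<open>(1, 0, 0)\<close>, given by the parameters \<open>\<xi>, \<theta>\<close>, that is tangent to the cubic.\<close>
  define \<xi> where "\<xi> = - (w1 + w2) / (w1 * w2)"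
  define \<theta> where "\<theta> = - 1 / (w1 + w2)"
  have \<xi>: "\<xi> \<noteq> 0" using w_distinct by (auto simp: \<xi>_def add_eq_0_iff)
  have \<theta>: "\<theta> * (w1 + w2) = - 1" and \<xi>_mult: "\<xi> * (w1 * w2) = - (w1 + w2)"
    using w_distinct by (simp_all add: \<theta>_def \<xi>_def)
  \<comment> \<open>\<open>\<xi>\<close> and \<open>\<xi> * \<theta>\<close> are the u and v for
    which 1 + u X + v X^2 has the roots \<open>w1\<close> and \<open>w2\<close>, so the second and
    third coordinates vanish.\<close>
  have line: "\<xi> * (w1 + w1\<^sup>2 * \<theta>) = - 1" "\<xi> * (w2 + w2\<^sup>2 * \<theta>) = - 1"
  proof -
    have *: "(w1 + w2) * (\<xi> * (t + t\<^sup>2 * \<theta>)) = \<xi> * t * (w1 + w2 - t)" for t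
    proof -
      have eq: "(w1 + w2) * (\<xi> * (t + t\<^sup>2 * \<theta>)) = \<xi> * t * (w1 + w2) + \<xi> * t\<^sup>2 * (\<theta> * (w1 + w2))"
        by (simp add: algebra_simps)
      show ?thesis unfolding eq \<theta> by (simp add: algebra_simps power2_eq_square)
    qed
    have "(w1 + w2) * (\<xi> * (w1 + w1\<^sup>2 * \<theta>)) = (w1 + w2) * - 1"
      "(w1 + w2) * (\<xi> * (w2 + w2\<^sup>2 * \<theta>)) = (w1 + w2) * - 1"
      unfolding * using \<xi>_mult by (simp_all add: algebra_simps)
    then show "\<xi> * (w1 + w1\<^sup>2 * \<theta>) = - 1" "\<xi> * (w2 + w2\<^sup>2 * \<theta>) = - 1"
      using w_distinct(6) by (simp_all only: mult_cancel_left) simp_all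
  qed
  \<comment> \<open>Otherwise conjugation makes the norm of \<open>b0\<close> minus that of
    \<open>a0\<close>, against \<open>norm\<close> in odd characteristic.\<close>
  have ab: "a2 + b0 \<noteq> 0"
  proof
    assume "a2 + b0 = 0"
    then have b0': "b0 = - a2" by (simp add: add_eq_0_iff)
    then have "b1 = - a0" using a b frob_minus[of a2] by simp
    moreover from this have "b2 = - a1" using a b frob_minus[of a0] by simp
    ultimately have "2 * (a0 * a1 * a2) = 0" using norm b0' by (simp add: algebra_simps)
    moreover have "a1 \<noteq> 0" "a2 \<noteq> 0" using a a0 by auto
    ultimately show False using a0 two_nz by simp
  qed
  \<comment> \<open>The conic is u = \<open>g\<close>, v = t \<open>g\<close>, with \<open>g\<close>
    taking the value \<open>\<xi>\<close> at \<open>\<theta>\<close>. The slope \<open>r\<close>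
    solves the tangent equation there.\<close>
  define r where "r = \<xi>\<^sup>2 * (a2 * w1\<^sup>2 + b0 * w2\<^sup>2) / (a2 + b0)"
  define g where "g = [:\<xi> - r * \<theta>, r:]"
  define e where "e = (\<lambda>t. poly (coord t) g)"
  have e: "e t = 1 + g * [:t, t\<^sup>2:]" for t by (simp add: e_def coord_altdef)
  have val: "poly (e t) \<theta> = 1 + \<xi> * (t + t\<^sup>2 * \<theta>)" for t
    by (simp add: e g_def algebra_simps)
  have der: "poly (pderiv (e t)) \<theta> = r * (t + t\<^sup>2 * \<theta>) + \<xi> * t\<^sup>2" for t
    unfolding e g_def by (simp add: pderiv_add pderiv_mult pderiv_pCons algebra_simps)
  have e': "poly (coord' (t ^ q)) g = e t ^ q" for t
    by (simp add: e_def flip: coord_frob)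
  have "CHAR('a) dvd q" using char q2 by (cases n) auto
  then have "of_nat q = (0 :: 'a)" by (simp add: of_nat_eq_0_iff_char_dvd)
  then have der': "pderiv (e t ^ q) = 0" for t by (simp add: pderiv_power)
  let ?x = "poly (e w) \<theta>" and ?dx = "poly (pderiv (e w)) \<theta>"
    and ?dy = "poly (pderiv (e w1)) \<theta>" and ?dz = "poly (pderiv (e w2)) \<theta>"
  have y0: "poly (e w1) \<theta> = 0" and z0: "poly (e w2) \<theta> = 0" using line by (simp_all add: val)
  have x0: "?x \<noteq> 0"
  proof -
    have "w1 * w2 * ?x = w1 * w2 + (\<xi> * (w1 * w2)) * (w + w\<^sup>2 * \<theta>)"
      by (simp add: val algebra_simps)
    also have "\<dots> = w1 * w2 - (w1 + w2) * w - w\<^sup>2 * (\<theta> * (w1 + w2))"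
      unfolding \<xi>_mult by (simp add: algebra_simps)
    also have "\<dots> = (w - w1) * (w - w2)"
      unfolding \<theta> by (simp add: algebra_simps power2_eq_square)
    finally show ?thesis using w w_distinct by auto
  qed
  define F where "F = poly \<Phi> g"
  have F: "F = cubic [:a0:] [:a1:] [:a2:] [:b0:] [:b1:] [:b2:] [:s:] (e w) (e w1) (e w2)"
    unfolding F_def \<Phi>_def poly_cubic by (simp add: e_def)
  define T where "T = poly T3 g"
  have T: "T = wp_num [:a0:] [:a1:] [:a2:] [:b0:] [:b1:] [:b2:] [:s:] (e w) (e w1) (e w2)
      (e w2 ^ q) (e w ^ q) (e w1 ^ q)"
    unfolding T_def T3_def poly_wp_num using e'[of w] e'[of w1] e'[of w2] by (simp add: e_def w)
  define L where "L = poly L3 g"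
  have L: "L = e w * e w ^ q - e w2 ^ q * e w1"
    unfolding L_def L3_def using e'[of w] e'[of w2] by (simp add: e_def w)
  have "F dvd T - [:c:] * L\<^sup>2"
  proof -
    obtain G where "T3 - C c * L3\<^sup>2 = \<Phi> * G" using c by blast
    then have "poly (T3 - C c * L3\<^sup>2) g = poly (\<Phi> * G) g" by simp
    then show ?thesis by (simp add: T_def L_def F_def)
  qed
  then obtain G where G: "T - [:c:] * L\<^sup>2 = F * G" by blast
  have z: "(0::'a) ^ q = 0" using q2 by simp
  have "poly (e w2 ^ q) \<theta> = 0" "poly (e w1 ^ q) \<theta> = 0" using y0 z0 z by simp_all
  note at = wp_num_at[OF y0 z0 this der'[of w2] der'[of w] der'[of w1],
      of a0 a1 a2 b0 b1 b2 s "e w", folded T]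
  have L_at: "poly L \<theta> = ?x * ?x ^ q" "poly (pderiv L) \<theta> = ?dx * ?x ^ q"
    using z by (simp_all add: L y0 z0 pderiv_diff pderiv_mult der')
  have F_at: "poly F \<theta> = 0" using y0 z0 by (simp add: F poly_cubic cubic_def)
  have l: "w1 + w1\<^sup>2 * \<theta> = - 1 / \<xi>" "w2 + w2\<^sup>2 * \<theta> = - 1 / \<xi>"
    using line \<xi> by (simp_all add: field_simps)
  have tangent: "a2 * ?dy + b0 * ?dz = 0"
  proof -
    have "a2 * ?dy + b0 * ?dz = - r * (a2 + b0) / \<xi> + \<xi> * (a2 * w1\<^sup>2 + b0 * w2\<^sup>2)"
      unfolding der l using \<xi> by (simp add: field_simps)
    also have "r * (a2 + b0) = \<xi>\<^sup>2 * (a2 * w1\<^sup>2 + b0 * w2\<^sup>2)" using ab by (simp add: r_def)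
    then have "- r * (a2 + b0) / \<xi> = - \<xi> * (a2 * w1\<^sup>2 + b0 * w2\<^sup>2)"
      using \<xi> by (simp add: power2_eq_square)
    finally show ?thesis by (simp add: algebra_simps)
  qed
  have F_der: "poly (pderiv F) \<theta> = 0" unfolding F pderiv_cubic_at[OF y0 z0] tangent by simp
  have "poly (T - [:c:] * L\<^sup>2) \<theta> = 0" unfolding G using F_at by simp
  then have "(a0 * b0 - c) * (?x * ?x ^ q)\<^sup>2 = 0" using at(1) L_at by (simp add: algebra_simps power_mult_distrib)
  then have c: "c = a0 * b0" using x0 by simp
  \<comment> \<open>\<open>F\<close> has a double zero at \<open>\<theta>\<close>, hence so has this
    multiple of it. The terms in dx then cancel because \<open>c = a0 * b0\<close>.\<close>
  have "poly (pderiv (T - [:c:] * L\<^sup>2)) \<theta> = 0"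
    unfolding G using F_at F_der by (simp add: pderiv_mult)
  then have "(?x ^ q)\<^sup>2 * ?x * (a0 * a1 * ?dz - (a0 * s + b1 * b2) * ?dy) = 0"
    using at(2) L_at
    by (simp add: c pderiv_diff pderiv_mult pderiv_smult power2_eq_square algebra_simps)
  then have eq: "a0 * a1 * ?dz = (a0 * s + b1 * b2) * ?dy" using x0 by simp
  have dy: "?dy \<noteq> 0"
  proof
    assume dy: "?dy = 0"
    then have "?dz = 0" using tangent b0 by simp
    with dy have "\<xi> * w1\<^sup>2 - \<xi> * w2\<^sup>2 = 0"
      unfolding der l by (simp add: eq_neg_iff_add_eq_0 add.commute)
    then have "\<xi> * (w1 - w2) * (w1 + w2) = 0" by (simp add: algebra_simps power2_eq_square)
    then show False using \<xi> w_distinct by simp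
  qed
  have "((a0 * s + b1 * b2) * b0 + a0 * a1 * a2) * ?dy = b0 * ((a0 * s + b1 * b2) * ?dy - a0 * a1 * ?dz) +
      a0 * a1 * (a2 * ?dy + b0 * ?dz)" by (simp add: algebra_simps)
  also have "\<dots> = 0" using eq tangent by simp
  finally have "(a0 * s + b1 * b2) * b0 + a0 * a1 * a2 = 0" using dy by simp
  then show ?thesis using norm by (simp add: algebra_simps)
qed

end

section \<open>Additive maps and finite fields\<close>

lemma bij_additive_iff:
  fixes h :: "'a::{finite,ab_group_add} \<Rightarrow> 'a"
  assumes "\<And>x y. h (x - y) = h x - h y"
  shows "bij h \<longleftrightarrow> (\<forall>x. h x = 0 \<longrightarrow> x = 0)"
proof -
  have "h 0 = 0" using assms[of 0 0] by simp
  then have "inj h \<longleftrightarrow> (\<forall>x. h x = 0 \<longrightarrow> x = 0)"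
    unfolding inj_def using assms by (metis diff_self right_minus_eq)
  moreover have "bij h \<longleftrightarrow> inj h" using finite_UNIV_inj_surj[of h] by (auto simp: bij_def)
  ultimately show ?thesis by simp
qed

lemma finite_field_power_card: "x ^ card (UNIV :: 'a set) = x" for x :: "'a::{field,finite}"
proof (cases "x = 0")
  case False
  have pos: "card (UNIV :: 'a set) > 0" by (simp add: card_gt_0_iff)
  have "(\<Prod>y\<in>UNIV - {0}. x * y) = (\<Prod>y\<in>UNIV - {0}. y)"
    by (rule prod.reindex_bij_witness[of _ "\<lambda>y. y / x" "\<lambda>y. x * y"]) (use False in auto)
  then have "x ^ card (UNIV - {0 :: 'a}) = 1"
    by (simp add: prod.distrib)
  then have "x ^ Suc (card (UNIV :: 'a set) - 1) = x" by (simp add: card_Diff_singleton)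
  then show ?thesis using pos by simp
qed (simp add: zero_power card_gt_0_iff)

section \<open>Planarity\<close>

locale cubic_extension =
  fixes p m q :: nat and a :: "'a::{field,finite}" and b :: "nat \<Rightarrow> nat \<Rightarrow> 'a"
  assumes p: "prime p" "odd p" and q: "q = p ^ m" and card: "card (UNIV :: 'a set) = q ^ 3"
    and a: "a \<noteq> 0"
begin

lemma q2: "q \<ge> 2" and m: "m > 0"
proof -
  have "card {0, 1 :: 'a} \<le> card (UNIV :: 'a set)" by (intro card_mono) auto
  then have "2 \<le> q ^ 3" by (simp add: card)
  then have "q \<noteq> 0" "q \<noteq> 1" by (auto intro: Nat.gr0I)
  then show "q \<ge> 2" by simp
  show "m > 0" using \<open>q \<noteq> 1\<close> q by (cases m) auto
qed

lemma odd_q: "odd q"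
  using p q by simp

lemma char: "CHAR('a) = p"
proof -
  have "CHAR('a) > 0" by (rule finite_imp_CHAR_pos) simp
  then have pr: "prime CHAR('a)" by (rule prime_CHAR_semidom)
  have "CHAR('a) dvd p ^ (m * 3)" using CHAR_dvd_CARD[where ?'a = 'a] by (simp add: card q power_mult)
  then have "CHAR('a) dvd p" using pr prime_dvd_power by blast
  then show ?thesis using pr p(1) by (simp add: primes_dvd_imp_eq)
qed

lemma pow_add: "(x + y) ^ p ^ k = x ^ p ^ k + y ^ p ^ k" for x y :: 'a
  using freshmans_dream'[of "p ^ k" k x y] p char by simp

lemma frob_add: "(x + y) ^ q = x ^ q + y ^ q" for x y :: 'a
  unfolding q by (rule pow_add)

lemma frob_minus: "(- x) ^ q = - (x ^ q)" for x :: 'a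
  using odd_q by simp

lemma frob3: "((x ^ q) ^ q) ^ q = x" for x :: 'a
  using finite_field_power_card[of x] by (simp add: card power3_eq_cube power_mult)

lemma two_nz: "(2 :: 'a) \<noteq> 0"
proof
  assume "(2 :: 'a) = 0"
  then have "p dvd 2" using of_nat_eq_0_iff_char_dvd[where ?'a = 'a, of 2] char by simp
  then show False using p by (metis primes_dvd_imp_eq two_is_prime_nat dvd_refl)
qed

lemma frob_2: "(2 :: 'a) ^ q = 2"
  using frob_add[of 1 1] by simp

text \<open>The upper bound counts roots of X^q - X. For the lower bound, the trace maps all q^3
  elements into the fixed field with fibres of at most q^2 elements.\<close>

lemma card_fixed: "card {x :: 'a. x ^ q = x} = q"
proof (rule antisym)
  have poly: "card {x :: 'a. poly P x = 0} \<le> n" if "degree P \<le> n" "P \<noteq> 0" for P n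
    using card_poly_roots_bound[OF that(2)] that(1) by linarith
  define P where "P = (monom 1 q - [:0, 1:] :: 'a poly)"
  have "coeff P q = 1" using q2 by (simp add: P_def coeff_pCons split: nat.splits)
  then have "P \<noteq> 0" by auto
  moreover have "degree P \<le> q" unfolding P_def using q2 by (intro degree_diff_le degree_monom_le) auto
  ultimately show "card {x :: 'a. x ^ q = x} \<le> q" using poly[of P q] by (simp add: P_def poly_monom)
next
  have fibre: "card {y :: 'a. Tr3 q y = t} \<le> q\<^sup>2" for t
  proof -
    define P where "P = (monom 1 (q\<^sup>2) + monom 1 q + [:- t, 1:] :: 'a poly)"
    have "q < q\<^sup>2" using q2 by (auto simp: power2_eq_square)
    then have lt: "q < q\<^sup>2" "1 < q\<^sup>2" using q2 by linarith+
    have "coeff [:- t, 1:] (q\<^sup>2) = 0" using lt by (intro coeff_eq_0) simp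
    then have "coeff P (q\<^sup>2) = 1" using lt by (simp add: P_def)
    then have "P \<noteq> 0" by auto
    moreover have "degree P \<le> q\<^sup>2"
      unfolding P_def using lt by (intro degree_add_le order.trans[OF degree_monom_le]) auto
    ultimately have "card {x. poly P x = 0} \<le> q\<^sup>2" using card_poly_roots_bound[of P] by linarith
    moreover have "{x. poly P x = 0} = {y. Tr3 q y = t}"
      by (auto simp: P_def poly_monom Tr3_def algebra_simps)
    ultimately show ?thesis by simp
  qed
  have Tr_fixed: "Tr3 q y ^ q = Tr3 q y" for y :: 'a
    using frob3[of y] by (simp add: Tr3_def frob_add power2_eq_square power_mult)
  have "q ^ 3 \<le> card (\<Union>t\<in>{x :: 'a. x ^ q = x}. {y. Tr3 q y = t})"
    unfolding card[symmetric] using Tr_fixed by (intro card_mono) auto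
  also have "\<dots> \<le> (\<Sum>t\<in>{x :: 'a. x ^ q = x}. card {y. Tr3 q y = t})" by (rule card_UN_le) simp
  also have "\<dots> \<le> (\<Sum>t\<in>{x :: 'a. x ^ q = x}. q\<^sup>2)" by (rule sum_mono) (rule fibre)
  also have "\<dots> = card {x :: 'a. x ^ q = x} * q\<^sup>2" by simp
  finally have "q * q\<^sup>2 \<le> card {x :: 'a. x ^ q = x} * q\<^sup>2" by (simp add: power3_eq_cube power2_eq_square)
  then show "q \<le> card {x :: 'a. x ^ q = x}" using q2 by (subst (asm) mult_le_cancel2) simp
qed

text \<open>It remains to supply an element \<open>w\<close> outside F_q, which exists since q <
  q^3.\<close>

lemma relation_of_pointless:
  fixes \<alpha> \<beta> s :: 'a
  assumes "\<alpha> \<noteq> 0" "\<beta> \<noteq> 0" "s ^ q = s"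
    and "\<alpha> * \<alpha> ^ q * (\<alpha> ^ q) ^ q = \<beta> * \<beta> ^ q * (\<beta> ^ q) ^ q"
    and "\<And>c. c \<noteq> 0 \<Longrightarrow> cubic \<alpha> (\<alpha> ^ q) ((\<alpha> ^ q) ^ q) \<beta> (\<beta> ^ q) ((\<beta> ^ q) ^ q) s c (c ^ q) ((c ^ q) ^ q) \<noteq> 0"
  shows "s * \<alpha> * \<beta> + 2 * (\<alpha> * \<alpha> ^ q * (\<alpha> ^ q) ^ q) = 0"
proof -
  have "{x :: 'a. x ^ q = x} \<noteq> UNIV"
  proof
    assume "{x :: 'a. x ^ q = x} = UNIV"
    then have "q = q ^ 3" using card_fixed card by simp
    then show False using q2 by (simp add: power3_eq_cube)
  qed
  then obtain w :: 'a where "w ^ q \<noteq> w" by blast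
  then interpret pointless_cubic q m \<alpha> "\<alpha> ^ q" "(\<alpha> ^ q) ^ q" \<beta> "\<beta> ^ q" "(\<beta> ^ q) ^ q" s w "w ^ q" "(w ^ q) ^ q"
    using p char q odd_q q2 assms frob3 card_fixed by unfold_locales auto
  show ?thesis by (rule pointless_relation)
qed

section \<open>Polarisation and the substitution z = x c\<close>

definition lp where "lp = linpoly p m b"

text \<open>The polarisation f(x + c) - f(x) - f(c).\<close>

definition bil :: "'a \<Rightarrow> 'a \<Rightarrow> 'a" where
  "bil x c = Tr3 q (a * (x ^ q * c + x * c ^ q)) + 2 * lp (x * c)"

lemma Tr_add: "Tr3 q (x + y) = Tr3 q x + Tr3 q y" for x y :: 'a
  by (simp add: Tr3_def frob_add power2_eq_square power_mult)

lemma Tr_altdef: "Tr3 q y = y + y ^ q + (y ^ q) ^ q" for y :: 'a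
  by (simp add: Tr3_def power2_eq_square power_mult)

lemma Tr_fixed: "Tr3 q y ^ q = Tr3 q y" for y :: 'a
  using frob3[of y] by (simp add: Tr_altdef frob_add)

lemma lp_add: "lp (x + y) = lp x + lp y"
proof -
  have "(x + y) ^ (p ^ i * (p ^ m) ^ j) = x ^ (p ^ i * (p ^ m) ^ j) + y ^ (p ^ i * (p ^ m) ^ j)" for i j
    using pow_add[of x y "i + m * j"] by (simp add: power_add power_mult)
  then show ?thesis by (simp add: lp_def linpoly_def distrib_left sum.distrib)
qed

lemma lp_0: "lp 0 = 0"
  using lp_add[of 0 0] by (metis add_0 add_cancel_right_right)

lemma lp_diff: "lp (x - y) = lp x - lp y"
  using lp_add[of "x - y" y] by simp

text \<open>For fixed \<open>c\<close> the difference map is a translate of the additive map sending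
  \<open>x\<close> to \<open>bil x c\<close>, so it is bijective exactly when that map has trivial
  kernel.\<close>

lemma planar_iff:
  "planar (\<lambda>x. Tr3 q (a * x ^ (q + 1)) + lp (x\<^sup>2)) \<longleftrightarrow> (\<forall>c x. c \<noteq> 0 \<longrightarrow> x \<noteq> 0 \<longrightarrow> bil x c \<noteq> 0)"
proof -
  let ?f = "\<lambda>x. Tr3 q (a * x ^ (q + 1)) + lp (x\<^sup>2)"
  have "bij (\<lambda>x. ?f (x + c) - ?f x) \<longleftrightarrow> (\<forall>x. bil x c = 0 \<longrightarrow> x = 0)" for c
  proof -
    have eq: "?f (x + c) - ?f x = ?f c + bil x c" for x
    proof -
      have "(x + c) ^ (q + 1) = x ^ (q + 1) + (x ^ q * c + x * c ^ q) + c ^ (q + 1)"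
        by (simp add: frob_add algebra_simps)
      then have "a * (x + c) ^ (q + 1) = a * x ^ (q + 1) + a * (x ^ q * c + x * c ^ q) + a * c ^ (q + 1)"
        by (simp only: distrib_left)
      moreover have "(x + c)\<^sup>2 = x\<^sup>2 + (x * c + x * c) + c\<^sup>2" by (simp add: power2_eq_square algebra_simps)
      ultimately show ?thesis unfolding bil_def by (simp only: Tr_add lp_add) simp
    qed
    have "bij (\<lambda>x. ?f (x + c) - ?f x) \<longleftrightarrow> bij (\<lambda>x. bil x c)"
    proof -
      have "(\<lambda>x. ?f (x + c) - ?f x) = (+) (?f c) \<circ> (\<lambda>x. bil x c)" by (simp only: eq comp_def)
      moreover have "bij ((+) (?f c) \<circ> h) \<longleftrightarrow> bij h" for h :: "'a \<Rightarrow> 'a"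
        using bij_comp[of h "(+) (?f c)"] bij_comp[of "(+) (?f c) \<circ> h" "(+) (- ?f c)"]
        by (auto simp: comp_def)
      ultimately show ?thesis by simp
    qed
    also have "\<dots> \<longleftrightarrow> (\<forall>x. bil x c = 0 \<longrightarrow> x = 0)"
    proof (rule bij_additive_iff)
      fix x y
      have "bil (u + y) c = bil u c + bil y c" for u
      proof -
        have "a * ((u + y) ^ q * c + (u + y) * c ^ q) = a * (u ^ q * c + u * c ^ q) + a * (y ^ q * c + y * c ^ q)"
          by (simp add: frob_add algebra_simps)
        then show ?thesis unfolding bil_def by (simp only: Tr_add distrib_right lp_add) simp
      qed
      from this[of "x - y"] show "bil (x - y) c = bil x c - bil y c" by simp
    qed
    finally show ?thesis .
  qed
  then show ?thesis unfolding planar_def by blast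
qed

text \<open>Putting x = z / c frees the argument of \<open>lp\<close> from c; multiplication by the
  norm of c then clears the denominators.\<close>

lemma bil_cubic:
  assumes "c \<noteq> 0"
  shows "c * c ^ q * (c ^ q) ^ q * bil (z / c) c =
    cubic (a * z) ((a * z) ^ q) (((a * z) ^ q) ^ q) (a * z ^ q) ((a * z ^ q) ^ q) (((a * z ^ q) ^ q) ^ q)
      (- 2 * lp z) c (c ^ q) ((c ^ q) ^ q)"
proof -
  define c1 c2 where "c1 = c ^ q" and "c2 = c1 ^ q"
  have nz: "c1 \<noteq> 0" "c2 \<noteq> 0" using assms by (auto simp: c1_def c2_def)
  define z1 z2 where "z1 = z ^ q" and "z2 = z1 ^ q"
  define a1 a2 where "a1 = a ^ q" and "a2 = a1 ^ q"
  have "z2 ^ q = z" "c2 ^ q = c" by (simp_all add: z2_def z1_def c2_def c1_def frob3)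
  then have "bil (z / c) c = a * (z1 / c1 * c + z / c * c1) + a1 * (z2 / c2 * c1 + z1 / c1 * c2) +
      a2 * (z / c * c2 + z2 / c2 * c) + 2 * lp z"
    using assms
    by (simp add: bil_def Tr_altdef frob_add power_mult_distrib power_divide
        flip: c1_def c2_def z1_def z2_def a1_def a2_def)
  \<comment> \<open>With names for the quotients, z becomes a product and the remaining identity is
    polynomial.\<close>
  moreover define u u1 u2 where "u = z / c" and "u1 = z1 / c1" and "u2 = z2 / c2"
  ultimately have bil: "bil (z / c) c = a * (u1 * c + u * c1) + a1 * (u2 * c1 + u1 * c2) +
      a2 * (u * c2 + u2 * c) + 2 * lp z"
    by (simp only:)
  have u: "z = u * c" "z1 = u1 * c1" "z2 = u2 * c2" using assms nz by (simp_all add: u_def u1_def u2_def)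
  have "c * c1 * c2 * bil (z / c) c = cubic (a * z) (a1 * z1) (a2 * z2) (a * z1) (a1 * z2) (a2 * z)
      (- 2 * lp z) c c1 c2"
    unfolding bil unfolding cubic_def u by (simp add: algebra_simps power2_eq_square)
  moreover have "((a * z) ^ q) ^ q = a2 * z2" "(a * z) ^ q = a1 * z1"
    "((a * z1) ^ q) ^ q = a2 * z" "(a * z1) ^ q = a1 * z2"
    using \<open>z2 ^ q = z\<close> by (simp_all add: power_mult_distrib a1_def a2_def z1_def z2_def)
  ultimately show ?thesis
    unfolding c1_def[symmetric] c2_def[symmetric] z1_def[symmetric] by (simp only:)
qed

definition Na where "Na = a * a ^ q * (a ^ q) ^ q"

lemma Na: "Na \<noteq> 0" "Na ^ q = Na"
  using a frob3[of a] by (simp_all add: Na_def power_mult_distrib mult_ac)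

lemma planar_imp:
  assumes planar: "\<And>c x. c \<noteq> 0 \<Longrightarrow> x \<noteq> 0 \<Longrightarrow> bil x c \<noteq> 0"
  shows "bij lp" "\<And>t. t ^ q = t \<Longrightarrow> lp ((a ^ q)\<^sup>2 * t) = Na * t"
proof -
  define a1 a2 where "a1 = a ^ q" and "a2 = a1 ^ q"
  have a2q: "a2 ^ q = a" by (simp add: a1_def a2_def frob3)
  have nz: "a1 \<noteq> 0" "a2 \<noteq> 0" using a by (simp_all add: a1_def a2_def)
  have Na_eq: "Na = a * a1 * a2" by (simp add: Na_def a1_def a2_def)
  have key: "lp z * a = a1 * a2 * (z ^ q) ^ q" if fixed: "lp z ^ q = lp z" for z
  proof (cases "z = 0")
    case True
    then show ?thesis using q2 by (simp add: lp_0)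
  next
    case False
    define z1 z2 where "z1 = z ^ q" and "z2 = z1 ^ q"
    have z2q: "z2 ^ q = z" by (simp add: z1_def z2_def frob3)
    have z_nz: "z1 \<noteq> 0" "z2 \<noteq> 0" using False by (simp_all add: z1_def z2_def)
    have "- 2 * lp z * (a * z) * (a * z ^ q) +
        2 * (a * z * (a * z) ^ q * ((a * z) ^ q) ^ q) = 0"
    proof (rule relation_of_pointless)
      show "a * z \<noteq> 0" "a * z ^ q \<noteq> 0" using a False by simp_all
      show "(- 2 * lp z) ^ q = - 2 * lp z"
        using frob_minus[of "2 * lp z"] by (simp add: power_mult_distrib frob_2 fixed)
      show "a * z * (a * z) ^ q * ((a * z) ^ q) ^ q = a * z ^ q * (a * z ^ q) ^ q * ((a * z ^ q) ^ q) ^ q"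
        by (simp add: power_mult_distrib frob3 mult_ac)
      fix c :: 'a assume c: "c \<noteq> 0"
      have "c * c ^ q * (c ^ q) ^ q * bil (z / c) c \<noteq> 0" using planar[OF c] c False by simp
      then show "cubic (a * z) ((a * z) ^ q) (((a * z) ^ q) ^ q) (a * z ^ q) ((a * z ^ q) ^ q)
          (((a * z ^ q) ^ q) ^ q) (- 2 * lp z) c (c ^ q) ((c ^ q) ^ q) \<noteq> 0"
        by (simp only: bil_cubic[OF c] not_False_eq_True)
    qed
    then have "2 * (a * z * z1) * (a1 * a2 * z2 - lp z * a) = 0"
      by (simp add: power_mult_distrib algebra_simps flip: z1_def z2_def a1_def a2_def)
    then show ?thesis using two_nz a False z_nz by (simp flip: z1_def z2_def)
  qed
  \<comment> \<open>Since 0 is fixed by Frobenius, \<open>key\<close> applies to the kernel.\<close>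
  have "z = 0" if "lp z = 0" for z
    using key[of z] that nz q2 by simp
  then show bij: "bij lp" by (simp add: bij_additive_iff[of lp, OF lp_diff])
  fix t :: 'a assume t: "t ^ q = t"
  \<comment> \<open>The preimage z has its image in F_q, so the conjugate of \<open>key\<close>
    determines z.\<close>
  obtain z where z: "lp z = Na * t" using bij by (metis bij_pointE)
  have fixed: "lp z ^ q = lp z" by (simp add: z power_mult_distrib t Na(2))
  have "(lp z * a) ^ q = (a1 * a2 * (z ^ q) ^ q) ^ q" using key[OF fixed] by simp
  then have "lp z * a1 = a2 * a * z" by (simp add: power_mult_distrib fixed a2q frob3 flip: a1_def a2_def)
  then have "(a2 * a) * z = lp z * a1" by simp
  also have "\<dots> = (a2 * a) * (a1\<^sup>2 * t)" by (simp add: z Na_eq power2_eq_square mult_ac)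
  finally have "(a2 * a) * z = (a2 * a) * (a1\<^sup>2 * t)" .
  then have "z = a1\<^sup>2 * t" using nz a by (subst (asm) mult_cancel_left) auto
  then show "lp ((a ^ q)\<^sup>2 * t) = Na * t" using z by (simp add: a1_def)
qed

text \<open>A zero of \<open>bil\<close> puts \<open>lp z\<close> into F_q, so injectivity gives z =
  a^(2q) t with t in F_q. For such z the cubic is a product of three conjugate lines without
  rational points.\<close>

lemma planar_if:
  assumes bij: "bij lp" and lin: "\<And>t. t ^ q = t \<Longrightarrow> lp ((a ^ q)\<^sup>2 * t) = Na * t"
    and c: "c \<noteq> 0" and x: "x \<noteq> 0"
  shows "bil x c \<noteq> 0"
proof
  assume 0: "bil x c = 0"
  define z where "z = x * c"
  have z: "z \<noteq> 0" "z / c = x" using c x by (simp_all add: z_def)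
  have "(2 * lp z) ^ q = 2 * lp z"
  proof -
    have "2 * lp z = - Tr3 q (a * (x ^ q * c + x * c ^ q))"
      using 0 by (simp add: bil_def z_def eq_neg_iff_add_eq_0 add.commute)
    then show ?thesis using frob_minus Tr_fixed by simp
  qed
  then have fixed: "lp z ^ q = lp z" using two_nz by (simp add: power_mult_distrib frob_2)
  define t where "t = lp z / Na"
  have t: "t ^ q = t" by (simp add: t_def power_divide fixed Na)
  have "lp ((a ^ q)\<^sup>2 * t) = lp z" using lin[OF t] Na by (simp add: t_def)
  then have zt: "z = (a ^ q)\<^sup>2 * t" using bij by (metis bij_is_inj injD)
  define a1 a2 where "a1 = a ^ q" and "a2 = a1 ^ q"
  have a2q: "a2 ^ q = a" by (simp add: a1_def a2_def frob3)
  define c1 c2 where "c1 = c ^ q" and "c2 = c1 ^ q"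
  have c2q: "c2 ^ q = c" by (simp add: c1_def c2_def frob3)
  have sq: "(x\<^sup>2) ^ q = (x ^ q)\<^sup>2" for x :: 'a by (simp add: mult.commute flip: power_mult)
  have zs: "z = a1\<^sup>2 * t" "z ^ q = a2\<^sup>2 * t" "(z ^ q) ^ q = a\<^sup>2 * t"
    using zt by (simp_all add: power_mult_distrib sq t a2q flip: a1_def a2_def)
  have lpz: "lp z = a * a1 * a2 * t" using Na by (simp add: t_def Na_def a1_def a2_def)
  have "t \<noteq> 0" using z zs by auto
  have "cubic (a * z) ((a * z) ^ q) (((a * z) ^ q) ^ q) (a * z ^ q) ((a * z ^ q) ^ q)
      (((a * z ^ q) ^ q) ^ q) (- 2 * lp z) c (c ^ q) ((c ^ q) ^ q) = 0"
    using bil_cubic[OF c, of z] 0 z by simp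
  moreover have A: "((a * z) ^ q) ^ q = a2 * (z ^ q) ^ q" "(a * z) ^ q = a1 * z ^ q"
    "((a * z ^ q) ^ q) ^ q = a2 * z" "(a * z ^ q) ^ q = a1 * (z ^ q) ^ q"
    by (simp_all add: power_mult_distrib frob3 a1_def a2_def)
  ultimately have "cubic (a * z) (a1 * z ^ q) (a2 * (z ^ q) ^ q) (a * z ^ q) (a1 * (z ^ q) ^ q)
      (a2 * z) (- 2 * lp z) c c1 c2 = 0"
    by (simp only: A flip: c1_def c2_def)
  then have "cubic (a * (a1\<^sup>2 * t)) (a1 * (a2\<^sup>2 * t)) (a2 * (a\<^sup>2 * t)) (a * (a2\<^sup>2 * t)) (a1 * (a\<^sup>2 * t))
      (a2 * (a1\<^sup>2 * t)) (- 2 * (a * a1 * a2 * t)) c c1 c2 = 0"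
    unfolding lpz zs(3) unfolding zs(2) unfolding zs(1) .
  then have "t * ((a2 * c + a1 * c1) * (a * c1 + a2 * c2) * (a1 * c2 + a * c)) = 0"
    by (simp add: cubic_def algebra_simps power2_eq_square)
  then have or: "a2 * c + a1 * c1 = 0 \<or> a * c1 + a2 * c2 = 0 \<or> a1 * c2 + a * c = 0"
    using \<open>t \<noteq> 0\<close> by simp
  have fr: "(a2 * c + a1 * c1) ^ q = a * c1 + a2 * c2" "(a * c1 + a2 * c2) ^ q = a1 * c2 + a * c"
    "(a1 * c2 + a * c) ^ q = a2 * c + a1 * c1"
    by (simp_all add: frob_add power_mult_distrib a2q c2q flip: a1_def a2_def c1_def c2_def)
  \<comment> \<open>Frobenius permutes the three factors, so one vanishing factor makes all of them
    vanish.\<close>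
  have "y = 0" if "x ^ q = y" "x = 0" for x y :: 'a using that q2 by (auto simp: zero_power)
  from this[OF fr(1)] this[OF fr(2)] this[OF fr(3)] or
  have all: "a2 * c + a1 * c1 = 0" "a * c1 + a2 * c2 = 0" "a1 * c2 + a * c = 0"
    by blast+
  then have neg: "a1 * c1 = - (a2 * c)" "a2 * c2 = - (a * c1)" "a * c = - (a1 * c2)"
    by (simp_all add: eq_neg_iff_add_eq_0 add.commute)
  \<comment> \<open>Multiplying the three equations gives N(a) N(c) = - N(a) N(c).\<close>
  have "(a1 * c1) * (a2 * c2) * (a * c) = (- (a2 * c)) * (- (a * c1)) * (- (a1 * c2))"
    unfolding neg ..
  then have "2 * (a * a1 * a2 * c * c1 * c2) = 0" by (simp add: algebra_simps)
  then show False using two_nz a c by (simp add: a1_def a2_def c1_def c2_def)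
qed

section \<open>The coefficient condition\<close>

definition coef where "coef i = (\<Sum>j<3. b i j * a ^ (2 * p ^ i * q ^ (j + 1)))"

text \<open>Raising to powers of q fixes \<open>t\<close>, so the three terms with the same p^i
  merge.\<close>

lemma lp_line:
  assumes t: "t ^ q = t"
  shows "lp ((a ^ q)\<^sup>2 * t) = (\<Sum>i<m. coef i * t ^ (p ^ i))"
proof -
  have tq: "t ^ (q ^ j) = t" for j
    by (induction j) (simp_all add: power_mult t)
  have "((a ^ q)\<^sup>2 * t) ^ (p ^ i * q ^ j) = a ^ (2 * p ^ i * q ^ (j + 1)) * t ^ (p ^ i)" for i j
  proof -
    have "t ^ (p ^ i * q ^ j) = t ^ (p ^ i)" by (subst mult.commute) (simp add: power_mult tq)
    moreover have "((a ^ q)\<^sup>2) ^ (p ^ i * q ^ j) = a ^ (2 * p ^ i * q ^ (j + 1))"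
      by (simp add: mult_ac flip: power_mult)
    ultimately show ?thesis by (simp add: power_mult_distrib)
  qed
  then show ?thesis
    unfolding lp_def linpoly_def q[symmetric] coef_def by (simp add: sum_distrib_right mult.assoc)
qed

text \<open>The difference of the two sides is a polynomial in t of degree at most p^(m - 1) < q; if
  it vanishes on the q elements of F_q, all its coefficients are zero.\<close>

lemma coef_iff:
  "(\<forall>t. t ^ q = t \<longrightarrow> lp ((a ^ q)\<^sup>2 * t) = Na * t) \<longleftrightarrow> (\<forall>i<m. coef i = (if i = 0 then Na else 0))"
proof
  assume coef: "\<forall>i<m. coef i = (if i = 0 then Na else 0)"
  show "\<forall>t. t ^ q = t \<longrightarrow> lp ((a ^ q)\<^sup>2 * t) = Na * t"
  proof (intro allI impI)
    fix t :: 'a assume "t ^ q = t"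
    then have "lp ((a ^ q)\<^sup>2 * t) = (\<Sum>i<m. coef i * t ^ (p ^ i))" by (rule lp_line)
    also have "\<dots> = (\<Sum>i<m. if i = 0 then Na * t else 0)" using coef by (intro sum.cong) auto
    also have "\<dots> = Na * t" using m by simp
    finally show "lp ((a ^ q)\<^sup>2 * t) = Na * t" .
  qed
next
  assume lin: "\<forall>t. t ^ q = t \<longrightarrow> lp ((a ^ q)\<^sup>2 * t) = Na * t"
  define d where "d i = coef i - (if i = 0 then Na else 0)" for i
  define P where "P = (\<Sum>i<m. monom (d i) (p ^ i))"
  have p1: "p > 1" using p(1) by (rule prime_gt_1_nat)
  have "degree P \<le> p ^ (m - 1)"
    unfolding P_def using p1
    by (intro degree_sum_le order.trans[OF degree_monom_le] power_increasing) auto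
  also have "p ^ (m - 1) < q" unfolding q using p1 m by (intro power_strict_increasing) auto
  finally have deg: "degree P < q" .
  have "P = 0"
  proof (rule poly_eqI_degree[where A = "{t. t ^ q = t}"])
    fix t assume "t \<in> {t :: 'a. t ^ q = t}"
    then have t: "t ^ q = t" by simp
    have "poly P t = (\<Sum>i<m. coef i * t ^ p ^ i - (if i = 0 then Na * t else 0))"
      unfolding P_def d_def by (auto simp: poly_sum poly_monom algebra_simps intro!: sum.cong)
    also have "\<dots> = lp ((a ^ q)\<^sup>2 * t) - Na * t" using m by (simp add: sum_subtractf lp_line[OF t])
    finally show "poly P t = poly 0 t" using lin t by simp
  qed (use deg card_fixed q2 in auto)
  show "\<forall>i<m. coef i = (if i = 0 then Na else 0)"
  proof (intro allI impI)
    fix i assume i: "i < m"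
    have "coeff P (p ^ i) = (\<Sum>k<m. if k = i then d k else 0)"
      unfolding P_def coeff_sum using p1 by (intro sum.cong) auto
    then have "d i = 0" using i \<open>P = 0\<close> by simp
    then show "coef i = (if i = 0 then Na else 0)" by (simp add: d_def)
  qed
qed

lemma planar_characterization:
  "planar (\<lambda>x. Tr3 q (a * x ^ (q + 1)) + lp (x\<^sup>2)) \<longleftrightarrow>
    bij lp \<and> (\<forall>i<m. coef i = (if i = 0 then Na else 0))"
  unfolding planar_iff coef_iff[symmetric] using planar_imp planar_if by blast

end

theorem theorem2p7:
  fixes p m :: nat and b :: "nat \<Rightarrow> nat \<Rightarrow> 'a::{field,finite}" and a :: 'a
  assumes "prime p" and "odd p"
    and "card (UNIV :: 'a set) = (p ^ m) ^ 3"
    and "a \<noteq> 0"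
  shows "planar (\<lambda>x. Tr3 (p ^ m) (a * x ^ (p ^ m + 1)) + linpoly p m b (x ^ 2))
     \<longleftrightarrow> bij (linpoly p m b) \<and>
         (\<forall>i<m. (\<Sum>j<3. b i j * a ^ (2 * p ^ i * (p ^ m) ^ (j + 1)))
                  = (if i = 0 then N3 (p ^ m) a else 0))"
proof -
  interpret cubic_extension p m "p ^ m" a b
    using assms by unfold_locales auto
  have "N3 (p ^ m) a = Na"
    by (simp add: N3_def Na_def power_add power2_eq_square power_mult)
  then show ?thesis
    using planar_characterization by (simp only: lp_def coef_def)
qed

end
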